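(* Suppose two-phase HotStuff (with the view-1 optimization) is run with the FastSync synchronizer with timeout function $F$. Assume that $S_{\rm first}\ge\mathsf{GST}$, $F(1)>5\delta$ and $\mathsf{leader}(1)$ is correct. Then all correct processes decide no later than $S_{\rm last}+4\delta$.
   Context: Model. There are $n=3f+1$ processes $p_1,\dots,p_n$, at most $f$ of which are faulty (Byzantine, behaving arbitrarily); the others are correct. A quorum is a set of $2f+1$ processes. Processes communicate over authenticated point-to-point links. Partial synchrony: there are a time $\mathsf{GST}$ and a bound $\delta$, both unknown to the protocol, such that after $\mathsf{GST}$ messages between correct processes are delayed by at most $\delta$; before $\mathsf{GST}$ messages may be arbitrarily delayed or lost (self-addressed messages are never lost). Local clocks may drift unboundedly before $\mathsf{GST}$ and do not drift from real time after it. Local processing takes zero time. $\langle m\rangle_i$ denotes $m$ signed by $p_i$; signatures are unforgeable and $\mathsf{hash}$ is collision-resistant (both idealized as perfect). Each correct process has a proposal $\mathtt{myval}()$ satisfying a given predicate $\mathsf{valid}$. Synchronizer. Views are $1,2,\dots$; $0$ denotes an invalid view. The synchronizer issues notifications $\mathtt{new\_view}(v)$ at each correct process, which then enters $v$ and stays in it until it enters another view. Each correct process eventually calls $\mathtt{start}()$; $S_{\rm first}$ and $S_{\rm last}$ are the earliest and latest times when a correct process does so. The timeout function $F:\{0,1,2,\dots\}\to\mathsf{Time}$ is monotone, $F(0)=0$, and for every $\theta$ there is $v$ with $F(v')>\theta$ for all $v'\ge v$. FastSync (code of $p_i$), with retransmission interval $\rho$. Each process has an array $\mathsf{max\_views}[1..n]$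 and variables $\mathsf{view}$, $\mathsf{view}^+$, all initially $0$, and a timer $\mathsf{timer\_view}$, initially not enabled. "All" includes the sender. - $\mathtt{start}()$: if $\mathsf{view}^+=0$, send $\mathtt{WISH}(1)$ to all. - When $\mathsf{timer\_view}$ expires: send $\mathtt{WISH}(\max(\mathsf{view}+1,\mathsf{view}^+))$ to all. - Every $\rho$ units of local time: if $\mathsf{timer\_view}$ is enabled, send $\mathtt{WISH}(\mathsf{view}^+)$ to all; otherwise, if $\mathsf{max\_views}[i]>0$, send $\mathtt{WISH}(\max(\mathsf{view}+1,\mathsf{view}^+))$ to all. - When $\mathtt{WISH}(v)$ is received from $p_j$: let $prev=\mathsf{view}$, $prev^+=\mathsf{view}^+$. If $v>\mathsf{max\_views}[j]$, set $\mathsf{max\_views}[j]:=v$. Set $\mathsf{view}$ (resp. $\mathsf{view}^+$) to the largest value $u$ occurring in $\mathsf{max\_views}$ such that at least $2f+1$ (resp. $f+1$) entries are $\ge u$. If $\mathsf{view}^+=\mathsf{view}$ and $\mathsf{view}>prev$, restart $\mathsf{timer\_view}$ with duration $F(\mathsf{view})$ and issue $\mathtt{new\_view}(\mathsf{view})$. Finally, if $\mathsf{view}^+>prev^+$, send $\mathtt{WISH}(\mathsf{view}^+)$ to all. Two-phase HotStuff (code of $p_i$), with leader-wait timeout function $F_p$. $\mathsf{leader}(v)=p_{((v-1)\bmod n)+1}$. Variables $\mathsf{curr\_view},\mathsf{prepared\_view},\mathsf{locked\_view}$ are initially $0$; $\mathsf{curr\_val},\mathsf{prepared\_val},\mathsf{cert},\mathsf{voted}$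 are initially $\bot$; $\mathsf{timer\_newleader}$ is a timer. A handler runs when its trigger and precondition hold; messages for views higher than the current one are buffered (for each type and sender, only the one with the highest view is kept). 1. Upon $\mathtt{new\_view}(v)$: $\mathsf{curr\_view}:=v$; $\mathsf{voted}:=$ false; stop $\mathsf{timer\_newleader}$; if $p_i=\mathsf{leader}(v)$, start $\mathsf{timer\_newleader}$ with duration $F_p(v)$; send $\langle\mathtt{NEWLEADER}(v,\mathsf{prepared\_view},\mathsf{prepared\_val},\mathsf{cert})\rangle_i$ to $\mathsf{leader}(v)$. 2. (Once per view.) When $\mathsf{timer\_newleader}$ has expired, with $\mathsf{curr\_view}=v$ and $p_i=\mathsf{leader}(v)$: let $M=\{\langle\mathtt{NEWLEADER}(v,view_j,val_j,cert_j)\rangle_j\mid p_j\in P\}$ be the set of all received messages for $v$ satisfying ValidNewLeader; if there is $j$ with $view_j=\max\{view_k\mid p_k\in P\}\ne0$, send $\langle\mathtt{PROPOSE}(v,val_j,cert_j)\rangle_i$ to all; else send $\langle\mathtt{PROPOSE}(v,\mathtt{myval}(),\bot)\rangle_i$ to all. 3. When $m=\langle\mathtt{PROPOSE}(v,x,\_)\rangle_j$ is received, with $\mathsf{curr\_view}=v$, $\mathsf{voted}=$ false, SafeProposal$(m)$: $\mathsf{curr\_val}:=x$; $\mathsf{voted}:=$ true; send $\langle\mathtt{PREPARED}(v,\mathsf{hash}(x))\rangle_i$ to all. 4. When $C=\{\langle\mathtt{PREPARED}(v,h)\rangle_j\mid p_j\in Q\}$ is received for a quorum $Q$, with $\mathsf{curr\_view}=v$,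 $\mathsf{voted}=$ true, $\mathsf{hash}(\mathsf{curr\_val})=h$: $\mathsf{prepared\_val}:=\mathsf{curr\_val}$; $\mathsf{prepared\_view}:=v$; $\mathsf{locked\_view}:=v$; $\mathsf{cert}:=C$; send $\langle\mathtt{COMMITTED}(v,h)\rangle_i$ to all. 5. When $\{\langle\mathtt{COMMITTED}(v,h)\rangle_j\mid p_j\in Q\}$ is received for a quorum $Q$, with $\mathsf{curr\_view}=\mathsf{locked\_view}=v$, $\mathsf{hash}(\mathsf{curr\_val})=h$: decide $\mathsf{curr\_val}$. View-1 optimization: the leader of view $1$ sends $\langle\mathtt{PROPOSE}(1,\mathtt{myval}(),\bot)\rangle_i$ immediately on entering view $1$, without waiting (so step 2 is not used in view $1$). Predicates: prepared$(C,v,h)$ iff $C=\{\langle\mathtt{PREPARED}(v,h)\rangle_j\mid p_j\in Q\}$ for some quorum $Q$. ValidNewLeader$(\langle\mathtt{NEWLEADER}(v',v,x,C)\rangle_{\_})$ iff $v<v'$ and ($v\ne0$ implies prepared$(C,v,\mathsf{hash}(x))$). SafeProposal$(\langle\mathtt{PROPOSE}(v,x,C)\rangle_i)$, evaluated at the receiving process, iff $p_i=\mathsf{leader}(v)$, $\mathsf{valid}(x)$, and ($\mathsf{locked\_view}\ne0$ implies that $x=\mathsf{prepared\_val}$ or there is $v'$ with $v>v'>\mathsf{locked\_view}$ and prepared$(C,v',\mathsf{hash}(x))$). *)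

theory Defs
  imports Complex_Main
begin

section \<open>The system\<close>

text \<open>Processes are the naturals \<open>1, \<dots>, n\<close> with \<open>n = 3 f + 1\<close>; here \<open>max_faulty\<close> is \<open>f\<close>,
  \<open>timeout\<close> is the synchronizer's \<open>F\<close>, \<open>leader_timeout\<close> is HotStuff's \<open>F\<^sub>p\<close>, and
  \<open>clock i t\<close> is the reading of the local clock of process \<open>i\<close> at real time \<open>t\<close>.
  The handlers below never refer to \<open>gst\<close>, \<open>delta\<close> or \<open>faulty\<close>.\<close>

record ('v, 'h) system =
  max_faulty :: nat
  faulty :: "nat set"
  gst :: real
  delta :: real
  rho :: real
  timeout :: "nat \<Rightarrow> real"
  leader_timeout :: "nat \<Rightarrow> real"
  clock :: "nat \<Rightarrow> real \<Rightarrow> real"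
  hash :: "'v \<Rightarrow> 'h"
  valid :: "'v \<Rightarrow> bool"
  myval :: "nat \<Rightarrow> 'v"

definition num_procs :: "('v, 'h) system \<Rightarrow> nat" where
  "num_procs S = 3 * max_faulty S + 1"

definition procs :: "('v, 'h) system \<Rightarrow> nat set" where
  "procs S = {1..num_procs S}"

definition correct :: "('v, 'h) system \<Rightarrow> nat set" where
  "correct S = procs S - faulty S"

definition quorum :: "('v, 'h) system \<Rightarrow> nat set \<Rightarrow> bool" where
  "quorum S Q \<longleftrightarrow> Q \<subseteq> procs S \<and> card Q = 2 * max_faulty S + 1"

text \<open>Only used for \<open>v \<ge> 1\<close>; the value at \<open>0\<close> is an artefact of truncated subtraction.\<close>

definition leader :: "('v, 'h) system \<Rightarrow> nat \<Rightarrow> nat" where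
  "leader S v = (v - 1) mod num_procs S + 1"

definition timeout_function :: "(nat \<Rightarrow> real) \<Rightarrow> bool" where
  "timeout_function F \<longleftrightarrow>
     mono F \<and> F 0 = 0 \<and> (\<forall>\<theta>. \<exists>v. \<forall>v'\<ge>v. F v' > \<theta>)"

text \<open>Perfect collision resistance is injectivity of \<open>hash\<close>. Before \<open>gst\<close> a clock is an arbitrary
  monotone function of real time.\<close>

definition well_formed_system :: "('v, 'h) system \<Rightarrow> bool" where
  "well_formed_system S \<longleftrightarrow>
     faulty S \<subseteq> procs S \<and> card (faulty S) \<le> max_faulty S \<and>
     0 \<le> gst S \<and> 0 \<le> delta S \<and> 0 < rho S \<and>
     timeout_function (timeout S) \<and>
     inj (hash S) \<and>
     (\<forall>i\<in>correct S. valid S (myval S i)) \<and>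
     (\<forall>i\<in>correct S. mono_on {0..} (clock S i) \<and>
        (\<forall>s t. gst S \<le> s \<and> s \<le> t \<longrightarrow> clock S i t - clock S i s = t - s))"


section \<open>Messages\<close>

text \<open>A certificate is a set of signed \<open>PREPARED\<close> messages; the triple \<open>(j, v, h)\<close> stands for
  \<open>PREPARED(v, h)\<close> signed by \<open>j\<close>. The option type renders a possibly undefined (bottom) value.\<close>

type_synonym 'h certificate = "(nat \<times> nat \<times> 'h) set"

datatype ('v, 'h) msg =
    NewLeader nat nat "'v option" "'h certificate option"
  | Propose nat 'v "'h certificate option"
  | Prepared nat 'h
  | Committed nat 'h

text \<open>\<open>Signed j m\<close> is \<open>m\<close> signed by \<open>j\<close>. A \<open>WISH\<close> is attributed to the process at the other end of
  the (authenticated) link, a signed message to its signer.\<close>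

datatype ('v, 'h) packet = Wish nat | Signed nat "('v, 'h) msg"

fun msg_view :: "('v, 'h) msg \<Rightarrow> nat" where
  "msg_view (NewLeader v _ _ _) = v"
| "msg_view (Propose v _ _) = v"
| "msg_view (Prepared v _) = v"
| "msg_view (Committed v _) = v"

fun same_type :: "('v, 'h) msg \<Rightarrow> ('v, 'h) msg \<Rightarrow> bool" where
  "same_type (NewLeader _ _ _ _) (NewLeader _ _ _ _) = True"
| "same_type (Propose _ _ _) (Propose _ _ _) = True"
| "same_type (Prepared _ _) (Prepared _ _) = True"
| "same_type (Committed _ _) (Committed _ _) = True"
| "same_type _ _ = False"

fun msg_certificate :: "('v, 'h) msg \<Rightarrow> 'h certificate" where
  "msg_certificate (NewLeader _ _ _ (Some C)) = C"
| "msg_certificate (Propose _ _ (Some C)) = C"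
| "msg_certificate _ = {}"

fun signatures :: "('v, 'h) packet \<Rightarrow> (nat \<times> ('v, 'h) msg) set" where
  "signatures (Wish v) = {}"
| "signatures (Signed j m) =
     insert (j, m) {(k, Prepared v h) |k v h. (k, v, h) \<in> msg_certificate m}"

definition to_all ::
    "('v, 'h) system \<Rightarrow> ('v, 'h) packet \<Rightarrow> (nat \<times> ('v, 'h) packet) set" where
  "to_all S w = procs S \<times> {w}"

definition certifies :: "('v, 'h) system \<Rightarrow> 'h certificate option \<Rightarrow> nat \<Rightarrow> 'h \<Rightarrow> bool" where
  "certifies S C v h \<longleftrightarrow> (\<exists>Q. quorum S Q \<and> C = Some {(j, v, h) |j. j \<in> Q})"


section \<open>Local states\<close>

text \<open>A timer is \<open>None\<close> when not enabled, otherwise \<open>Some d\<close> with \<open>d\<close> the local clock reading at which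
  it expires. \<open>inbox\<close> holds received signed messages, including the buffered ones, as pairs of signer
  and message. \<open>decided_view\<close> is an auxiliary variable: the last view in which the process decided.\<close>

record ('v, 'h) proc_state =
  max_views :: "nat \<Rightarrow> nat"
  view :: nat
  view_plus :: nat
  timer_view :: "real option"
  next_retransmit :: real
  curr_view :: nat
  prepared_view :: nat
  locked_view :: nat
  curr_val :: "'v option"
  prepared_val :: "'v option"
  cert :: "'h certificate option"
  voted :: "bool option"
  timer_newleader :: "real option"
  inbox :: "(nat \<times> ('v, 'h) msg) set"
  decided_view :: nat

text \<open>The phase of the periodic retransmission is arbitrary.\<close>

definition initial :: "('v, 'h) system \<Rightarrow> nat \<Rightarrow> ('v, 'h) proc_state \<Rightarrow> bool" where
  "initial S i s \<longleftrightarrow>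
     (\<exists>r. clock S i 0 \<le> r \<and> r \<le> clock S i 0 + rho S \<and>
        s = \<lparr> max_views = (\<lambda>_. 0), view = 0, view_plus = 0, timer_view = None,
              next_retransmit = r, curr_view = 0, prepared_view = 0, locked_view = 0,
              curr_val = None, prepared_val = None, cert = None, voted = None,
              timer_newleader = None, inbox = {}, decided_view = 0 \<rparr>)"

text \<open>A message for a view above the current one is buffered, keeping for each type and signer only
  one of highest view.\<close>

definition store :: "nat \<Rightarrow> ('v, 'h) msg \<Rightarrow> ('v, 'h) proc_state \<Rightarrow> ('v, 'h) proc_state" where
  "store j m s =
     (let buffered = {(j, m') |m'. (j, m') \<in> inbox s \<and> same_type m' m \<and> msg_view m' > curr_view s}
      in if msg_view m \<le> curr_view s then s\<lparr>inbox := insert (j, m) (inbox s)\<rparr>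
         else if \<exists>(k, m') \<in> buffered. msg_view m' \<ge> msg_view m then s
         else s\<lparr>inbox := insert (j, m) (inbox s - buffered)\<rparr>)"


section \<open>Handlers\<close>

text \<open>A handler maps a local state to the new local state and the set of packets sent, each paired with
  its destination; \<open>c\<close> is the local clock reading when the handler runs.\<close>

text \<open>HotStuff's reaction to \<open>new_view(v)\<close>, with the proposal sent at once in view 1.\<close>

definition enter_view ::
    "('v, 'h) system \<Rightarrow> nat \<Rightarrow> real \<Rightarrow> nat \<Rightarrow> ('v, 'h) proc_state \<Rightarrow>
     ('v, 'h) proc_state \<times> (nat \<times> ('v, 'h) packet) set" where
  "enter_view S i c v s =
     (s\<lparr> curr_view := v, voted := Some False,
         timer_newleader := (if i = leader S v then Some (c + leader_timeout S v) else None) \<rparr>,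
      {(leader S v, Signed i (NewLeader v (prepared_view s) (prepared_val s) (cert s)))} \<union>
      (if v = 1 \<and> i = leader S 1 then to_all S (Signed i (Propose 1 (myval S i) None)) else {}))"

definition kth_view :: "('v, 'h) system \<Rightarrow> nat \<Rightarrow> (nat \<Rightarrow> nat) \<Rightarrow> nat" where
  "kth_view S k mv = Max {u \<in> mv ` procs S. card {j \<in> procs S. mv j \<ge> u} \<ge> k}"

text \<open>Issuing \<open>new_view\<close> runs HotStuff's handler for it within the same step.\<close>

definition receive_wish ::
    "('v, 'h) system \<Rightarrow> nat \<Rightarrow> real \<Rightarrow> nat \<Rightarrow> nat \<Rightarrow> ('v, 'h) proc_state \<Rightarrow>
     ('v, 'h) proc_state \<times> (nat \<times> ('v, 'h) packet) set" where
  "receive_wish S i c j v s =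
     (let mv = (if v > max_views s j then (max_views s)(j := v) else max_views s);
          w = kth_view S (2 * max_faulty S + 1) mv;
          wp = kth_view S (max_faulty S + 1) mv;
          s1 = s\<lparr> max_views := mv, view := w, view_plus := wp \<rparr>;
          (s2, sent) =
            (if wp = w \<and> w > view s
             then enter_view S i c w (s1\<lparr> timer_view := Some (c + timeout S w) \<rparr>)
             else (s1, {}))
      in (s2, sent \<union> (if wp > view_plus s then to_all S (Wish wp) else {})))"

definition valid_new_leader ::
    "('v, 'h) system \<Rightarrow> nat \<Rightarrow> nat \<Rightarrow> 'v option \<Rightarrow> 'h certificate option \<Rightarrow> bool" where
  "valid_new_leader S v' v xo C \<longleftrightarrow>
     v < v' \<and> (v \<noteq> 0 \<longrightarrow> (\<exists>x. xo = Some x \<and> certifies S C v (hash S x)))"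

definition safe_proposal ::
    "('v, 'h) system \<Rightarrow> ('v, 'h) proc_state \<Rightarrow> nat \<Rightarrow> nat \<Rightarrow> 'v \<Rightarrow> 'h certificate option \<Rightarrow> bool" where
  "safe_proposal S s j v x C \<longleftrightarrow>
     j = leader S v \<and> valid S x \<and>
     (locked_view s \<noteq> 0 \<longrightarrow>
        prepared_val s = Some x \<or>
        (\<exists>v'. v > v' \<and> v' > locked_view s \<and> certifies S C v' (hash S x)))"

text \<open>The set \<open>M\<close> from which a leader selects its proposal, as tuples of signer, view, value and
  certificate.\<close>

definition new_leader_msgs ::
    "('v, 'h) system \<Rightarrow> ('v, 'h) proc_state \<Rightarrow>
     (nat \<times> nat \<times> 'v option \<times> 'h certificate option) set" where
  "new_leader_msgs S s =
     {(j, w, xo, C). (j, NewLeader (curr_view s) w xo C) \<in> inbox s \<and>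
                     valid_new_leader S (curr_view s) w xo C}"

definition may_propose ::
    "('v, 'h) system \<Rightarrow> nat \<Rightarrow> ('v, 'h) proc_state \<Rightarrow> 'v \<Rightarrow> 'h certificate option \<Rightarrow> bool" where
  "may_propose S i s x C \<longleftrightarrow>
     (let M = new_leader_msgs S s in
        (\<exists>j w. (j, w, Some x, C) \<in> M \<and> w \<noteq> 0 \<and> (\<forall>(j', w', x', C') \<in> M. w' \<le> w)) \<or>
        ((\<forall>(j', w', x', C') \<in> M. w' = 0) \<and> x = myval S i \<and> C = None))"

text \<open>The first argument of an event is the process taking the step. \<open>Receive i j k w\<close> is the receipt by
  \<open>i\<close> of the packet \<open>w\<close> sent to it by \<open>j\<close> in step number \<open>k\<close>. \<open>Lead\<close>, \<open>Vote\<close>, \<open>Prepare\<close> and \<open>Decide\<close> also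
  record the choices left open by the guards; \<open>Byzantine j A\<close> sends an arbitrary set \<open>A\<close> of packets.\<close>

datatype ('v, 'h) event =
    Start nat
  | Expire nat
  | Retransmit nat
  | Receive nat nat nat "('v, 'h) packet"
  | Lead nat 'v "'h certificate option"
  | Vote nat nat 'v "'h certificate option"
  | Prepare nat 'h "nat set"
  | Decide nat 'h "nat set"
  | Byzantine nat "(nat \<times> ('v, 'h) packet) set"

fun actor :: "('v, 'h) event \<Rightarrow> nat" where
  "actor (Start i) = i"
| "actor (Expire i) = i"
| "actor (Retransmit i) = i"
| "actor (Receive i _ _ _) = i"
| "actor (Lead i _ _) = i"
| "actor (Vote i _ _ _) = i"
| "actor (Prepare i _ _) = i"
| "actor (Decide i _ _) = i"
| "actor (Byzantine j _) = j"

text \<open>Guards of the handlers. The timer \<open>timer_newleader\<close> is disabled when \<open>Lead\<close> runs, which gives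
  "once per view"; in view 1 this handler is not used.\<close>

fun enabled :: "('v, 'h) system \<Rightarrow> real \<Rightarrow> ('v, 'h) proc_state \<Rightarrow> ('v, 'h) event \<Rightarrow> bool" where
  "enabled S c s (Start i) \<longleftrightarrow> True"
| "enabled S c s (Expire i) \<longleftrightarrow> (\<exists>d. timer_view s = Some d \<and> d \<le> c)"
| "enabled S c s (Retransmit i) \<longleftrightarrow> next_retransmit s \<le> c"
| "enabled S c s (Receive i j k w) \<longleftrightarrow> True"
| "enabled S c s (Lead i x C) \<longleftrightarrow>
     (\<exists>d. timer_newleader s = Some d \<and> d \<le> c) \<and>
     i = leader S (curr_view s) \<and> curr_view s \<noteq> 1 \<and> may_propose S i s x C"
| "enabled S c s (Vote i j x C) \<longleftrightarrow>
     (j, Propose (curr_view s) x C) \<in> inbox s \<and> voted s = Some False \<and>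
     safe_proposal S s j (curr_view s) x C"
| "enabled S c s (Prepare i h Q) \<longleftrightarrow>
     quorum S Q \<and> (\<forall>j\<in>Q. (j, Prepared (curr_view s) h) \<in> inbox s) \<and>
     voted s = Some True \<and> map_option (hash S) (curr_val s) = Some h"
| "enabled S c s (Decide i h Q) \<longleftrightarrow>
     quorum S Q \<and> (\<forall>j\<in>Q. (j, Committed (curr_view s) h) \<in> inbox s) \<and>
     locked_view s = curr_view s \<and> map_option (hash S) (curr_val s) = Some h"
| "enabled S c s (Byzantine j A) \<longleftrightarrow> False"

fun effect ::
    "('v, 'h) system \<Rightarrow> real \<Rightarrow> ('v, 'h) proc_state \<Rightarrow> ('v, 'h) event \<Rightarrow>
     ('v, 'h) proc_state \<times> (nat \<times> ('v, 'h) packet) set" where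
  "effect S c s (Start i) = (s, if view_plus s = 0 then to_all S (Wish 1) else {})"
| "effect S c s (Expire i) =
     (s\<lparr> timer_view := None \<rparr>, to_all S (Wish (max (view s + 1) (view_plus s))))"
| "effect S c s (Retransmit i) =
     (s\<lparr> next_retransmit := next_retransmit s + rho S \<rparr>,
      if timer_view s \<noteq> None then to_all S (Wish (view_plus s))
      else if max_views s i > 0 then to_all S (Wish (max (view s + 1) (view_plus s)))
      else {})"
| "effect S c s (Receive i j k w) =
     (case w of Wish v \<Rightarrow> receive_wish S i c j v s | Signed l m \<Rightarrow> (store l m s, {}))"
| "effect S c s (Lead i x C) =
     (s\<lparr> timer_newleader := None \<rparr>, to_all S (Signed i (Propose (curr_view s) x C)))"
| "effect S c s (Vote i j x C) =
     (s\<lparr> curr_val := Some x, voted := Some True \<rparr>,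
      to_all S (Signed i (Prepared (curr_view s) (hash S x))))"
| "effect S c s (Prepare i h Q) =
     (s\<lparr> prepared_val := curr_val s, prepared_view := curr_view s, locked_view := curr_view s,
         cert := Some {(j, curr_view s, h) |j. j \<in> Q} \<rparr>,
      to_all S (Signed i (Committed (curr_view s) h)))"
| "effect S c s (Decide i h Q) = (s\<lparr> decided_view := curr_view s \<rparr>, {})"
| "effect S c s (Byzantine j A) = (s, A)"

text \<open>Handlers that have to run before time advances. \<open>Prepare\<close> and \<open>Decide\<close> must run once per view as
  soon as they are enabled; their guards remain true afterwards, and running them again, for instance
  for another quorum, is allowed but not required. The equality \<open>locked_view s = curr_view s\<close> says
  exactly that \<open>Prepare\<close> has already run in the current view.\<close>

definition due :: "('v, 'h) system \<Rightarrow> nat \<Rightarrow> real \<Rightarrow> ('v, 'h) proc_state \<Rightarrow> bool" where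
  "due S i c s \<longleftrightarrow>
     enabled S c s (Expire i) \<or>
     enabled S c s (Retransmit i) \<or>
     (\<exists>x C. enabled S c s (Lead i x C)) \<or>
     (\<exists>j x C. enabled S c s (Vote i j x C)) \<or>
     (locked_view s \<noteq> curr_view s \<and> (\<exists>h Q. enabled S c s (Prepare i h Q))) \<or>
     (decided_view s \<noteq> curr_view s \<and> (\<exists>h Q. enabled S c s (Decide i h Q)))"


section \<open>Runs\<close>

text \<open>Step number \<open>n\<close> is the event \<open>events R n\<close> at real time \<open>times R n\<close>; it takes the local states from
  \<open>states R n\<close> to \<open>states R (Suc n)\<close> and sends the packets \<open>sends R n\<close>. Several steps may occur at
  the same time. States of faulty processes are meaningless.\<close>

record ('v, 'h) run =
  states :: "nat \<Rightarrow> nat \<Rightarrow> ('v, 'h) proc_state"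
  events :: "nat \<Rightarrow> ('v, 'h) event"
  times :: "nat \<Rightarrow> real"
  sends :: "nat \<Rightarrow> (nat \<times> ('v, 'h) packet) set"

definition correct_step :: "('v, 'h) system \<Rightarrow> ('v, 'h) run \<Rightarrow> nat \<Rightarrow> bool" where
  "correct_step S R n \<longleftrightarrow>
     (let e = events R n; i = actor e; c = clock S i (times R n) in
        i \<in> correct S \<and> enabled S c (states R n i) e \<and>
        (states R (Suc n) i, sends R n) = effect S c (states R n i) e)"

text \<open>Unforgeability: whatever a faulty process sends, every signature of a correct process in it was
  produced by that process when it sent the signed message earlier.\<close>

definition faulty_step :: "('v, 'h) system \<Rightarrow> ('v, 'h) run \<Rightarrow> nat \<Rightarrow> bool" where
  "faulty_step S R n \<longleftrightarrow>
     (\<exists>j A. events R n = Byzantine j A \<and> j \<in> faulty S \<and> sends R n = A \<and>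
        (\<forall>(d, w) \<in> A. \<forall>(l, m) \<in> signatures w.
           l \<in> faulty S \<or>
           (l \<in> correct S \<and>
             (\<exists>k<n. \<exists>d'. actor (events R k) = l \<and> (d', Signed l m) \<in> sends R k))))"

definition steps_ok :: "('v, 'h) system \<Rightarrow> ('v, 'h) run \<Rightarrow> bool" where
  "steps_ok S R \<longleftrightarrow>
     (\<forall>i\<in>correct S. initial S i (states R 0 i)) \<and>
     (\<forall>n. correct_step S R n \<or> faulty_step S R n) \<and>
     (\<forall>n. \<forall>i\<in>correct S. i \<noteq> actor (events R n) \<longrightarrow> states R (Suc n) i = states R n i)"

text \<open>The last conjunct of \<open>timing_ok\<close> is zero-time local processing and exactness of timers: whenever
  the state before step \<open>n\<close> persists through the time \<open>t\<close>, no handler is due in it at \<open>t\<close>.\<close>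

definition timing_ok :: "('v, 'h) system \<Rightarrow> ('v, 'h) run \<Rightarrow> bool" where
  "timing_ok S R \<longleftrightarrow>
     0 \<le> times R 0 \<and> mono (times R) \<and> (\<forall>t. \<exists>n. times R n > t) \<and>
     (\<forall>n t. 0 \<le> t \<and> (\<forall>m<n. times R m \<le> t) \<and> t < times R n \<longrightarrow>
        (\<forall>i\<in>correct S. \<not> due S i (clock S i t) (states R n i)))"

text \<open>A packet is identified by the sending step, its destination and its contents. Links neither create
  nor duplicate packets.\<close>

definition network_ok :: "('v, 'h) system \<Rightarrow> ('v, 'h) run \<Rightarrow> bool" where
  "network_ok S R \<longleftrightarrow>
     (\<forall>n i j k w. events R n = Receive i j k w \<longrightarrow>
        k < n \<and> actor (events R k) = j \<and> (i, w) \<in> sends R k \<and>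
        (\<forall>m<n. events R m \<noteq> Receive i j k w)) \<and>
     (\<forall>k j i w. actor (events R k) = j \<and> j \<in> correct S \<and> i \<in> correct S \<and>
        (i, w) \<in> sends R k \<and> times R k \<ge> gst S \<longrightarrow>
        (\<exists>n. events R n = Receive i j k w \<and> times R n \<le> times R k + delta S)) \<and>
     (\<forall>k i w. actor (events R k) = i \<and> i \<in> correct S \<and> (i, w) \<in> sends R k \<longrightarrow>
        (\<exists>n. events R n = Receive i i k w))"

definition starts_ok :: "('v, 'h) system \<Rightarrow> ('v, 'h) run \<Rightarrow> bool" where
  "starts_ok S R \<longleftrightarrow> (\<forall>i\<in>correct S. \<exists>!n. events R n = Start i)"

definition hotstuff_fastsync_run :: "('v, 'h) system \<Rightarrow> ('v, 'h) run \<Rightarrow> bool" where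
  "hotstuff_fastsync_run S R \<longleftrightarrow>
     well_formed_system S \<and> steps_ok S R \<and> timing_ok S R \<and> network_ok S R \<and> starts_ok S R"

definition start_times :: "('v, 'h) system \<Rightarrow> ('v, 'h) run \<Rightarrow> real set" where
  "start_times S R = {times R n |n i. i \<in> correct S \<and> events R n = Start i}"

definition S_first :: "('v, 'h) system \<Rightarrow> ('v, 'h) run \<Rightarrow> real" where
  "S_first S R = Min (start_times S R)"

definition S_last :: "('v, 'h) system \<Rightarrow> ('v, 'h) run \<Rightarrow> real" where
  "S_last S R = Max (start_times S R)"

definition decides_at :: "('v, 'h) run \<Rightarrow> nat \<Rightarrow> 'v \<Rightarrow> real \<Rightarrow> bool" where
  "decides_at R i x t \<longleftrightarrow>
     (\<exists>n h Q. events R n = Decide i h Q \<and> curr_val (states R n i) = Some x \<and> times R n = t)"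

end

(* Let E be the first time a correct process enters view 1. Everything correct processes send comes
   after gst. The wishes that let the first process in make all correct processes wish within delta, so
   all of them are in view 1 by E + 2 delta, and also by S_last + delta; call the smaller bound T. The
   proposal of the leader, the Prepared votes and the Committed votes each take delta, so everybody
   decides by T + 3 delta, provided that nobody leaves view 1 before that. Leaving needs a correct
   process that asks for view 2, which happens only when a view-1 timer has expired, hence not before
   E + F(1) > E + 5 delta. *)

theory Submission
  imports Defs
begin

section \<open>Order statistics of the view array\<close>

text \<open>A receiver still in view 0 keeps one buffered message per type and signer, so a view-1
  message could be refused or evicted. This does no harm: while no correct process asks for a view
  above 1, correct processes sign nothing above view 1, and apart from \<open>NewLeader\<close> only
  one possible view-1 message of each type. That nobody asks for view 2 rests on timers whose
  description presupposes just this; looking at the first offending step breaks the circle. Both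
  terms of the minimum T matter. The term E + 2 delta keeps T + 3 delta within E + 5 delta, hence
  before every timeout; S_last + delta yields the 4 delta of the conclusion. The second term alone
  would not do, since E may lie long before S_last.\<close>

lemma le_kth_view_iff:
  assumes "0 < k" and "k \<le> num_procs S"
  shows "u \<le> kth_view S k mv \<longleftrightarrow> k \<le> card {j \<in> procs S. u \<le> mv j}"
proof -
  let ?A = "{u \<in> mv ` procs S. card {j \<in> procs S. mv j \<ge> u} \<ge> k}"
  have fin: "finite ?A" "finite (procs S)"
    by (auto simp: procs_def)
  have ex: "\<exists>u'\<in>?A. u \<le> u'" if "k \<le> card {j \<in> procs S. u \<le> mv j}" for u
  proof -
    let ?B = "{j \<in> procs S. u \<le> mv j}"
    have B: "finite ?B" "?B \<noteq> {}"
      using that assms fin by auto (metis (no_types, lifting) card.empty empty_Collect_eq le_zero_eq not_gr_zero)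
    \<comment> \<open>\<open>kth_view\<close> ranges over values that occur in the array. Rounding
      \<open>u\<close> up to the least entry that reaches it gives such a value without losing any
      counted entry.\<close>
    define u' where "u' = Min (mv ` ?B)"
    have u': "u' \<in> mv ` ?B"
      unfolding u'_def using B by (intro Min_in) auto
    have "?B \<subseteq> {j \<in> procs S. u' \<le> mv j}"
      using B by (auto simp: u'_def)
    then have "k \<le> card {j \<in> procs S. u' \<le> mv j}"
      using that card_mono[of "{j \<in> procs S. u' \<le> mv j}" ?B] fin by simp
    then show ?thesis
      using u' by auto
  qed
  have "{j \<in> procs S. 0 \<le> mv j} = {1..num_procs S}"
    by (auto simp: procs_def)
  then have "card {j \<in> procs S. 0 \<le> mv j} = num_procs S"
    by (simp only: card_atLeastAtMost)
  then have "k \<le> card {j \<in> procs S. 0 \<le> mv j}"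
    using assms by simp
  then have "?A \<noteq> {}"
    using ex by blast
  then have "u \<le> kth_view S k mv \<longleftrightarrow> (\<exists>u'\<in>?A. u \<le> u')"
    unfolding kth_view_def using fin by (simp add: Max_ge_iff)
  also have "\<dots> \<longleftrightarrow> k \<le> card {j \<in> procs S. u \<le> mv j}"
  proof
    assume "\<exists>u'\<in>?A. u \<le> u'"
    then obtain u' where "k \<le> card {j \<in> procs S. u' \<le> mv j}" "u \<le> u'"
      by auto
    moreover have "card {j \<in> procs S. u' \<le> mv j} \<le> card {j \<in> procs S. u \<le> mv j}"
      using fin \<open>u \<le> u'\<close> by (intro card_mono) auto
    ultimately show "k \<le> card {j \<in> procs S. u \<le> mv j}"
      by simp
  qed (use ex in blast)
  finally show ?thesis .
qed

lemma kth_view_mono: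
  assumes "0 < k" and "k \<le> num_procs S" and "mv \<le> mv'"
  shows "kth_view S k mv \<le> kth_view S k mv'"
proof -
  have "card {j \<in> procs S. kth_view S k mv \<le> mv j} \<le> card {j \<in> procs S. kth_view S k mv \<le> mv' j}"
    using assms(3) by (intro card_mono) (auto simp: procs_def le_fun_def intro: order_trans)
  then show ?thesis
    using le_kth_view_iff[OF assms(1,2), of "kth_view S k mv"] by (meson order_refl order_trans)
qed

lemma kth_view_antimono:
  assumes "0 < k" and "k \<le> l" and "l \<le> num_procs S"
  shows "kth_view S l mv \<le> kth_view S k mv"
  using assms le_kth_view_iff[of l S "kth_view S l mv" mv] le_kth_view_iff[of k S "kth_view S l mv" mv]
  by simp

section \<open>Effects of receiving wishes and of storing signed messages\<close>

lemma update_max_view: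
  fixes mv :: "nat \<Rightarrow> nat"
  shows "(if v > mv j then mv(j := v) else mv) = mv(j := max v (mv j))"
  by auto

text \<open>Case analyses over events use these projections, because the handler hides its result
  behind nested pairs. \<open>enters\<close> is the condition under which \<open>new_view\<close> is
  issued.\<close>

lemma receive_wish_simps:
  fixes s :: "('v, 'h) proc_state"
  defines "mv \<equiv> \<lambda>j v (s :: ('v, 'h) proc_state). (max_views s)(j := max v (max_views s j))"
  defines "w \<equiv> \<lambda>S j v s. kth_view S (2 * max_faulty S + 1) (mv j v s)"
  defines "wp \<equiv> \<lambda>S j v s. kth_view S (max_faulty S + 1) (mv j v s)"
  defines "enters \<equiv> \<lambda>S j v s. wp S j v s = w S j v s \<and> w S j v s > view s"
  shows "max_views (fst (receive_wish S i c j v s)) = mv j v s"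
    and "view (fst (receive_wish S i c j v s)) = w S j v s"
    and "view_plus (fst (receive_wish S i c j v s)) = wp S j v s"
    and "timer_view (fst (receive_wish S i c j v s)) =
      (if enters S j v s then Some (c + timeout S (w S j v s)) else timer_view s)"
    and "curr_view (fst (receive_wish S i c j v s)) =
      (if enters S j v s then w S j v s else curr_view s)"
    and "voted (fst (receive_wish S i c j v s)) =
      (if enters S j v s then Some False else voted s)"
    and "locked_view (fst (receive_wish S i c j v s)) = locked_view s"
    and "decided_view (fst (receive_wish S i c j v s)) = decided_view s"
    and "curr_val (fst (receive_wish S i c j v s)) = curr_val s"
    and "inbox (fst (receive_wish S i c j v s)) = inbox s"
    and "snd (receive_wish S i c j v s) =
      (if enters S j v s
       then insert (leader S (w S j v s),
              Signed i (NewLeader (w S j v s) (prepared_view s) (prepared_val s) (cert s)))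
            (if w S j v s = 1 \<and> i = leader S 1
             then to_all S (Signed i (Propose 1 (myval S i) None)) else {})
       else {}) \<union>
      (if wp S j v s > view_plus s then to_all S (Wish (wp S j v s)) else {})"
  unfolding receive_wish_def Let_def update_max_view enters_def w_def wp_def mv_def enter_view_def
  by auto

lemma store_simps [simp]:
  "max_views (store j m s) = max_views s"
  "view (store j m s) = view s"
  "view_plus (store j m s) = view_plus s"
  "timer_view (store j m s) = timer_view s"
  "curr_view (store j m s) = curr_view s"
  "voted (store j m s) = voted s"
  "locked_view (store j m s) = locked_view s"
  "decided_view (store j m s) = decided_view s"
  "curr_val (store j m s) = curr_val s"
  by (simp_all add: store_def Let_def)

lemma inbox_store_subset: "inbox (store j m s) \<subseteq> insert (j, m) (inbox s)"
  by (auto simp: store_def Let_def)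

text \<open>A message is refused only in favour of a buffered one of the same type and signer whose
  view is at least as high; by the premise this can only be the message itself.\<close>

lemma inbox_store_insert:
  assumes "\<And>m'. (j, m') \<in> inbox s \<Longrightarrow> same_type m' m \<Longrightarrow> curr_view s < msg_view m' \<Longrightarrow>
    msg_view m \<le> msg_view m' \<Longrightarrow> m' = m"
  shows "(j, m) \<in> inbox (store j m s)"
  using assms by (auto simp: store_def Let_def)

text \<open>Storing \<open>m\<close> evicts only buffered messages of its signer with a strictly
  lower view.\<close>

lemma inbox_store_keep:
  assumes "(l, m') \<in> inbox s" and "l = j \<Longrightarrow> msg_view m \<le> msg_view m'"
  shows "(l, m') \<in> inbox (store j m s)"
  using assms by (auto simp: store_def Let_def not_le)

section \<open>Invariants of runs\<close>

locale hotstuff_run =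
  fixes S :: "('v, 'h) system" and R :: "('v, 'h) run"
  assumes run: "hotstuff_fastsync_run S R"
begin

abbreviation st :: "nat \<Rightarrow> nat \<Rightarrow> ('v, 'h) proc_state" where
  "st n i \<equiv> states R n i"

abbreviation clock_at :: "nat \<Rightarrow> nat \<Rightarrow> real" where
  "clock_at n i \<equiv> clock S i (times R n)"

section \<open>Counting correct processes and unfolding single steps\<close>

lemma finite_procs [simp]: "finite (procs S)"
  by (simp add: procs_def)

lemma finite_correct [simp]: "finite (correct S)"
  by (simp add: correct_def)

lemma correct_procs: "i \<in> correct S \<Longrightarrow> i \<in> procs S"
  by (simp add: correct_def)

lemma faulty_procs: "faulty S \<subseteq> procs S" and card_faulty: "card (faulty S) \<le> max_faulty S"
  using run by (auto simp: hotstuff_fastsync_run_def well_formed_system_def)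

lemma card_correct_part:
  assumes "A \<subseteq> procs S"
  shows "card A \<le> card (A \<inter> correct S) + max_faulty S"
proof -
  have "A = (A \<inter> correct S) \<union> (A \<inter> faulty S)"
    using assms by (auto simp: correct_def)
  then have "card A \<le> card (A \<inter> correct S) + card (A \<inter> faulty S)"
    by (metis card_Un_le)
  also have "card (A \<inter> faulty S) \<le> card (faulty S)"
    using faulty_procs finite_procs by (meson card_mono finite_subset inf_le2)
  finally show ?thesis
    using card_faulty by simp
qed

lemma card_correct: "2 * max_faulty S + 1 \<le> card (correct S)"
proof -
  have "procs S \<inter> correct S = correct S"
    by (auto simp: correct_def)
  then show ?thesis
    using card_correct_part[of "procs S"] by (simp add: procs_def num_procs_def)
qed

lemma correct_quorum:
  obtains Q where "quorum S Q" and "Q \<subseteq> correct S"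
  using obtain_subset_with_card_n[OF card_correct] correct_procs
  by (metis quorum_def subset_iff)

lemma threshold_bounds:
  "0 < 2 * max_faulty S + 1" "2 * max_faulty S + 1 \<le> num_procs S"
  "0 < max_faulty S + 1" "max_faulty S + 1 \<le> num_procs S"
  by (simp_all add: num_procs_def)

lemma network:
  assumes "events R n = Receive i j k w"
  shows "k < n" and "actor (events R k) = j" and "(i, w) \<in> sends R k"
  using assms run by (auto simp: hotstuff_fastsync_run_def network_ok_def)

lemma times_mono: "m \<le> n \<Longrightarrow> times R m \<le> times R n"
  using run by (auto simp: hotstuff_fastsync_run_def timing_ok_def mono_def)

lemma correct_stepD:
  assumes "i \<in> correct S" and "actor (events R n) = i"
  shows "enabled S (clock_at n i) (st n i) (events R n)"
    and "st (Suc n) i = fst (effect S (clock_at n i) (st n i) (events R n))"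
    and "sends R n = snd (effect S (clock_at n i) (st n i) (events R n))"
proof -
  have "\<not> faulty_step S R n"
    using assms by (auto simp: faulty_step_def correct_def)
  then have "correct_step S R n"
    using run by (auto simp: hotstuff_fastsync_run_def steps_ok_def)
  then show "enabled S (clock_at n i) (st n i) (events R n)"
    and "st (Suc n) i = fst (effect S (clock_at n i) (st n i) (events R n))"
    and "sends R n = snd (effect S (clock_at n i) (st n i) (events R n))"
    using assms(2) by (auto simp: correct_step_def Let_def prod_eq_iff)
qed

lemma idle:
  assumes "i \<in> correct S" and "actor (events R n) \<noteq> i"
  shows "st (Suc n) i = st n i"
  using assms run by (auto simp: hotstuff_fastsync_run_def steps_ok_def)

lemma initial_state: "i \<in> correct S \<Longrightarrow> initial S i (st 0 i)"
  using run by (auto simp: hotstuff_fastsync_run_def steps_ok_def)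

text \<open>Induction from the viewpoint of one process: others leave its state alone, and its own
  steps come with guard, effect and packets, so a case split on the event settles most
  invariants.\<close>

lemma invariant [consumes 1, case_names init idle step]:
  assumes "i \<in> correct S"
    and "initial S i (st 0 i) \<Longrightarrow> P 0"
    and "\<And>n. P n \<Longrightarrow> st (Suc n) i = st n i \<Longrightarrow> actor (events R n) \<noteq> i \<Longrightarrow> P (Suc n)"
    and "\<And>n e. P n \<Longrightarrow> events R n = e \<Longrightarrow> actor e = i \<Longrightarrow>
      enabled S (clock_at n i) (st n i) e \<Longrightarrow>
      st (Suc n) i = fst (effect S (clock_at n i) (st n i) e) \<Longrightarrow>
      sends R n = snd (effect S (clock_at n i) (st n i) e) \<Longrightarrow> P (Suc n)"
  shows "P n"
proof (induction n)
  case 0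
  then show ?case
    using assms(1,2) initial_state by blast
next
  case (Suc n)
  show ?case
  proof (cases "actor (events R n) = i")
    case True
    then show ?thesis
      using assms(4)[OF Suc refl True] correct_stepD[OF assms(1) True] by simp
  next
    case False
    then show ?thesis
      using assms(3)[OF Suc _ False] idle[OF assms(1) False] by simp
  qed
qed

section \<open>View counters and the wishes behind them\<close>

text \<open>Only \<open>receive_wish\<close> touches the array, and it recomputes both counters from
  it. As functions of the array they are monotone and open to counting.\<close>

lemma views_kth:
  assumes "i \<in> correct S"
  shows "view (st n i) = kth_view S (2 * max_faulty S + 1) (max_views (st n i)) \<and>
    view_plus (st n i) = kth_view S (max_faulty S + 1) (max_views (st n i))"
  using assms
proof (induction n rule: invariant)
  case init
  have "kth_view S k (\<lambda>_. 0) = 0" if "0 < k" "k \<le> num_procs S" for k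
    using le_kth_view_iff[OF that, of "Suc 0" "\<lambda>_. 0"] that by simp
  then show ?case
    using init threshold_bounds by (auto simp: initial_def)
next
  case (idle n)
  then show ?case
    by simp
next
  case (step n e)
  then show ?case
    by (cases e) (auto simp: receive_wish_simps split: packet.split)
qed

lemma le_view_iff:
  "i \<in> correct S \<Longrightarrow> u \<le> view (st n i) \<longleftrightarrow>
    2 * max_faulty S + 1 \<le> card {j \<in> procs S. u \<le> max_views (st n i) j}"
  using views_kth le_kth_view_iff threshold_bounds by metis

lemma le_view_plus_iff:
  "i \<in> correct S \<Longrightarrow> u \<le> view_plus (st n i) \<longleftrightarrow>
    max_faulty S + 1 \<le> card {j \<in> procs S. u \<le> max_views (st n i) j}"
  using views_kth le_kth_view_iff threshold_bounds by metis

lemma view_le_view_plus: "i \<in> correct S \<Longrightarrow> view (st n i) \<le> view_plus (st n i)"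
  using views_kth kth_view_antimono threshold_bounds
  by (metis add_le_mono1 le_add2 mult_2)

lemma views_Suc_mono:
  assumes "i \<in> correct S"
  shows "view (st n i) \<le> view (st (Suc n) i)" and "view_plus (st n i) \<le> view_plus (st (Suc n) i)"
proof -
  have "max_views (st n i) \<le> max_views (st (Suc n) i)"
  proof (cases "actor (events R n) = i")
    case True
    show ?thesis
      using correct_stepD(2)[OF assms True]
      by (cases "events R n") (auto simp: receive_wish_simps le_fun_def split: packet.split)
  qed (use idle assms in simp)
  then show "view (st n i) \<le> view (st (Suc n) i)"
    and "view_plus (st n i) \<le> view_plus (st (Suc n) i)"
    using views_kth[OF assms] kth_view_mono threshold_bounds by metis+
qed

lemma views_mono:
  assumes "i \<in> correct S" and "m \<le> n"
  shows "view (st m i) \<le> view (st n i)"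
  using assms(2) views_Suc_mono[OF assms(1)] by (auto intro: lift_Suc_mono_le)

text \<open>The wish is sent strictly before the step that receives it, which itself precedes
  \<open>n\<close>; hence \<open>Suc k < n\<close>. This slack lets a bound on the wishes sent
  before step \<open>n\<close> cover the state after step \<open>n\<close> as well.\<close>

lemma max_views_source:
  assumes "i \<in> correct S" and "0 < max_views (st n i) j"
  shows "\<exists>k. Suc k < n \<and> actor (events R k) = j \<and> (i, Wish (max_views (st n i) j)) \<in> sends R k"
  using assms
proof (induction n rule: invariant)
  case init
  then show ?case
    by (auto simp: initial_def)
next
  case (idle n)
  then show ?case
    by (metis less_SucI)
next
  case (step n e)
  show ?case
  proof (cases "max_views (st (Suc n) i) j = max_views (st n i) j")
    case True
    then show ?thesis
      using step by (metis less_Suc_eq)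
  next
    case False
    then obtain k where "e = Receive i j k (Wish (max_views (st (Suc n) i) j))"
      using step(3,5)
      by (cases e) (auto simp: receive_wish_simps max_def split: packet.splits if_splits)
    then show ?thesis
      using network[of n] \<open>events R n = e\<close> by (metis Suc_less_eq)
  qed
qed

lemma max_views_received:
  assumes "i \<in> correct S" and "k < n" and "events R k = Receive i j k' (Wish v)"
  shows "v \<le> max_views (st n i) j"
  using assms
proof (induction n rule: invariant)
  case init
  then show ?case
    by simp
next
  case (idle n)
  then show ?case
    by (auto simp: less_Suc_eq)
next
  case (step n e)
  then show ?case
    by (cases e) (auto simp: receive_wish_simps less_Suc_eq max_def split: packet.split)
qed

text \<open>Every handler broadcasts its wishes, so a correct wish that somebody has counted is also
  on its way to the others; \<open>view_positive_spread\<close> relies on this.\<close>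

lemma wish_sent_to_all:
  assumes "actor (events R k) \<in> correct S" and "(d, Wish v) \<in> sends R k" and "i \<in> procs S"
  shows "(i, Wish v) \<in> sends R k"
proof -
  show ?thesis
    using assms(2,3) correct_stepD(1,3)[OF assms(1) refl]
    by (cases "events R k")
      (auto simp: receive_wish_simps to_all_def split: packet.splits if_splits)
qed

text \<open>\<open>view_plus\<close> starts at 0, and every rise is announced to all in the step
  that makes it.\<close>

lemma view_plus_wish_sent:
  assumes "i \<in> correct S" and "0 < view_plus (st n i)"
  shows "\<exists>k<n. \<exists>v>0. actor (events R k) = i \<and> to_all S (Wish v) \<subseteq> sends R k"
  using assms
proof (induction n rule: invariant)
  case init
  then show ?case
    by (auto simp: initial_def)
next
  case (idle n)
  then show ?case
    by (metis less_SucI)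
next
  case (step n e)
  show ?case
  proof (cases "view_plus (st (Suc n) i) \<le> view_plus (st n i)")
    case True
    then show ?thesis
      using step by (metis less_Suc_eq order_less_le_trans)
  next
    case False
    then obtain j k v where "e = Receive i j k (Wish v)"
      using step by (cases e) (auto split: packet.splits)
    then have "to_all S (Wish (view_plus (st (Suc n) i))) \<subseteq> sends R n"
      using step(5,6) False by (simp add: receive_wish_simps)
    then show ?thesis
      using \<open>events R n = e\<close> \<open>actor e = i\<close> \<open>0 < view_plus (st (Suc n) i)\<close>
      by (metis lessI)
  qed
qed

lemma timer_view_positive:
  assumes "i \<in> correct S" and "timer_view (st n i) \<noteq> None"
  shows "0 < view (st n i)"
  using assms
proof (induction n rule: invariant)
  case init
  then show ?case
    by (auto simp: initial_def)
next
  case (idle n)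
  then show ?case
    by simp
next
  case (step n e)
  have "view (st n i) \<le> view (st (Suc n) i)"
    using views_Suc_mono(1)[OF assms(1), of n] step by simp
  then show ?case
    using step
    by (cases e) (auto simp: receive_wish_simps split: packet.splits if_splits)
qed

section \<open>Views of correct processes bounded by correct wishes\<close>

lemma correct_member:
  assumes "A \<subseteq> procs S" and "max_faulty S + 1 \<le> card A"
  obtains j where "j \<in> A" and "j \<in> correct S"
  using card_correct_part[OF assms(1)] assms(2)
  by (metis IntE Suc_eq_plus1 add_0 card.empty ex_in_conv not_less_eq_eq order_refl order_trans)

text \<open>Bounds the views that correct processes have asked for before step \<open>n\<close>. Bound \<open>0\<close> describes a
  run before the first start, bound \<open>1\<close> a run before the first timeout.\<close>

definition wishes_le :: "nat \<Rightarrow> nat \<Rightarrow> bool" where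
  "wishes_le b n \<longleftrightarrow>
    (\<forall>k<n. actor (events R k) \<in> correct S \<longrightarrow> (\<forall>d v. (d, Wish v) \<in> sends R k \<longrightarrow> v \<le> b))"

lemma wishes_le_antimono: "wishes_le b n \<Longrightarrow> m \<le> n \<Longrightarrow> wishes_le b m"
  unfolding wishes_le_def by (meson order_less_le_trans)

lemma max_views_le:
  assumes "wishes_le b n" and "m \<le> Suc n" and "i \<in> correct S" and "j \<in> correct S"
  shows "max_views (st m i) j \<le> b"
proof (cases "max_views (st m i) j = 0")
  case False
  then obtain k where "Suc k < m" "actor (events R k) = j"
    "(i, Wish (max_views (st m i) j)) \<in> sends R k"
    using max_views_source[OF assms(3)] by blast
  moreover have "k < n"
    using \<open>Suc k < m\<close> assms(2) by simp
  ultimately show ?thesis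
    using assms(1,4) unfolding wishes_le_def by blast
qed simp

text \<open>Faulty processes alone cannot raise \<open>view_plus\<close>: among \<open>f + 1\<close>
  entries one belongs to a correct process and is a wish that it sent.\<close>

lemma view_plus_le:
  assumes "wishes_le b n" and "m \<le> Suc n" and "i \<in> correct S"
  shows "view_plus (st m i) \<le> b"
proof (rule ccontr)
  assume "\<not> ?thesis"
  then have "max_faulty S + 1 \<le> card {j \<in> procs S. Suc b \<le> max_views (st m i) j}"
    using le_view_plus_iff[OF assms(3), of "Suc b" m] by simp
  then obtain j where "j \<in> correct S" "Suc b \<le> max_views (st m i) j"
    using correct_member[of "{j \<in> procs S. Suc b \<le> max_views (st m i) j}"] by auto
  then show False
    using max_views_le[OF assms] by fastforce
qed

lemma view_le:
  assumes "wishes_le b n" and "m \<le> Suc n" and "i \<in> correct S"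
  shows "view (st m i) \<le> b"
  using view_plus_le[OF assms] view_le_view_plus[OF assms(3)] order_trans by blast

text \<open>By induction nobody has a reason to speak: faulty wishes alone leave
  \<open>view_plus\<close> at 0, no timer runs in view 0, and retransmission needs a positive entry
  for oneself.\<close>

lemma wishes_le_0:
  assumes "\<And>k i. k < n \<Longrightarrow> i \<in> correct S \<Longrightarrow> events R k \<noteq> Start i"
  shows "wishes_le 0 n"
  using assms
proof (induction n)
  case 0
  then show ?case
    by (simp add: wishes_le_def)
next
  case (Suc n)
  then have IH: "wishes_le 0 n"
    by simp
  have "v = 0" if i: "i \<in> correct S" "actor (events R n) = i" and "(d, Wish v) \<in> sends R n" for i d v
  proof -
    have "view_plus (st n i) = 0" "view_plus (st (Suc n) i) = 0" "max_views (st n i) i = 0"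
      using view_plus_le[OF IH _ i(1)] max_views_le[OF IH _ i(1) i(1)] by force+
    moreover have "timer_view (st n i) = None"
      using timer_view_positive[OF i(1)] view_le[OF IH _ i(1), of n] by fastforce
    moreover have "events R n \<noteq> Start i"
      using Suc.prems i by blast
    ultimately show ?thesis
      using correct_stepD[OF i] that
      by (cases "events R n")
        (auto simp: receive_wish_simps to_all_def split: packet.splits if_splits)
  qed
  then show ?case
    using IH by (auto simp: wishes_le_def less_Suc_eq)
qed

text \<open>Equality fails in general: \<open>view\<close> can rise without \<open>new_view\<close>
  while \<open>view_plus\<close> is ahead of it.\<close>

lemma curr_view_le_view:
  assumes "i \<in> correct S"
  shows "curr_view (st n i) \<le> view (st n i)"
  using assms
proof (induction n rule: invariant)
  case init
  then show ?case
    by (auto simp: initial_def)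
next
  case (idle n)
  then show ?case
    by simp
next
  case (step n e)
  have "view (st n i) \<le> view (st (Suc n) i)"
    using views_Suc_mono(1)[OF assms(1)] .
  then show ?case
    using step
    by (cases e) (auto simp: receive_wish_simps split: packet.splits if_splits)
qed

section \<open>Provenance of signed messages and decisions\<close>

lemma correct_signer:
  assumes "actor (events R k) \<in> correct S" and "(d, Signed l m) \<in> sends R k"
  shows "l = actor (events R k)"
  using assms(2) correct_stepD(1,3)[OF assms(1) refl]
  by (cases "events R k")
    (auto simp: receive_wish_simps to_all_def split: packet.splits if_splits)

lemma signed_view_le:
  assumes "wishes_le b n" and "k < n" and "actor (events R k) \<in> correct S"
    and "(d, Signed l m) \<in> sends R k"
  shows "msg_view m \<le> b"
proof -
  let ?i = "actor (events R k)"
  have "curr_view (st k ?i) \<le> b" "view (st (Suc k) ?i) \<le> b"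
    using curr_view_le_view[OF assms(3), of k] view_le[OF assms(1) _ assms(3), of k]
      view_le[OF assms(1) _ assms(3), of "Suc k"] assms(2) by auto
  \<comment> \<open>Entering a view signs messages for the view reached by the step; every other
    handler signs for the view held before it.\<close>
  moreover have "msg_view m = view (st (Suc k) ?i) \<or> msg_view m = curr_view (st k ?i)"
  proof (cases "\<exists>i' j k' v. events R k = Receive i' j k' (Wish v)")
    case True
    then obtain i' j k' v where e: "events R k = Receive i' j k' (Wish v)"
      by blast
    then have "(d, Signed l m) \<in> snd (receive_wish S i' (clock_at k i') j v (st k i'))"
      using assms(4) correct_stepD(3)[OF assms(3) refl] by simp
    then have "msg_view m = view (fst (receive_wish S i' (clock_at k i') j v (st k i')))"
      unfolding receive_wish_simps by (auto simp: to_all_def split: if_splits)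
    then show ?thesis
      using e correct_stepD(2)[OF assms(3) refl] by simp
  next
    case False
    then show ?thesis
      using assms(4) correct_stepD(1,3)[OF assms(3) refl]
      by (cases "events R k")
        (auto simp: receive_wish_simps(11) to_all_def split: packet.splits if_splits)
  qed
  ultimately show ?thesis
    by auto
qed

text \<open>The sender \<open>j\<close> may be a faulty process relaying what \<open>l\<close>
  signed. Unforgeability leads back to a step of \<open>l\<close>, possibly with another
  destination.\<close>

lemma received_signed_origin:
  assumes "events R n = Receive i j k (Signed l m)" and "l \<in> correct S"
  shows "\<exists>k<n. actor (events R k) = l \<and> (\<exists>d. (d, Signed l m) \<in> sends R k)"
proof -
  note net = network[OF assms(1)]
  have "correct_step S R k \<or> faulty_step S R k"
    using run by (auto simp: hotstuff_fastsync_run_def steps_ok_def)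
  then show ?thesis
  proof
    assume "correct_step S R k"
    then have "l = j"
      using correct_signer net by (auto simp: correct_step_def Let_def)
    then show ?thesis
      using net by blast
  next
    assume "faulty_step S R k"
    moreover have "l \<notin> faulty S"
      using assms(2) by (simp add: correct_def)
    ultimately obtain k' d where "k' < k" "actor (events R k') = l" "(d, Signed l m) \<in> sends R k'"
      using net by (fastforce simp: faulty_step_def)
    then show ?thesis
      using net order_less_trans by blast
  qed
qed

lemma inbox_origin:
  assumes "i \<in> correct S" and "(l, m) \<in> inbox (st n i)" and "l \<in> correct S"
  shows "\<exists>k<n. actor (events R k) = l \<and> (\<exists>d. (d, Signed l m) \<in> sends R k)"
  using assms
proof (induction n rule: invariant)
  case init
  then show ?case
    by (auto simp: initial_def)
next
  case (idle n)
  then show ?case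
    by (metis less_SucI)
next
  case (step n e)
  show ?case
  proof (cases "(l, m) \<in> inbox (st n i)")
    case True
    then show ?thesis
      using step by (metis less_SucI)
  next
    case False
    then obtain j k where "e = Receive i j k (Signed l m)"
      using step inbox_store_subset
      by (cases e) (fastforce simp: receive_wish_simps split: packet.splits)+
    then show ?thesis
      using received_signed_origin[of n] step by (metis less_SucI)
  qed
qed

text \<open>Zero-time processing only speaks about the auxiliary \<open>decided_view\<close>; this
  recovers the decision that it records.\<close>

lemma decided_view_source:
  assumes "i \<in> correct S" and "decided_view (st n i) \<noteq> 0"
  shows "\<exists>k<n. \<exists>x. decides_at R i x (times R k)"
  using assms
proof (induction n rule: invariant)
  case init
  then show ?case
    by (auto simp: initial_def)
next
  case (idle n)
  then show ?case
    by (metis less_SucI)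
next
  case (step n e)
  show ?case
  proof (cases "decided_view (st (Suc n) i) = decided_view (st n i)")
    case True
    then show ?thesis
      using step by (metis less_SucI)
  next
    case False
    then obtain x where "decides_at R i x (times R n)"
      using step
      by (cases e) (auto simp: receive_wish_simps decides_at_def split: packet.splits)
    then show ?thesis
      by blast
  qed
qed

section \<open>Real time and step numbers\<close>

text \<open>The state with this index is the one after all steps up to and including time
  \<open>t\<close>, several of which may coincide in time.\<close>

definition steps_until :: "real \<Rightarrow> nat" where
  "steps_until t = (LEAST n. t < times R n)"

lemma less_steps_until_iff: "m < steps_until t \<longleftrightarrow> times R m \<le> t"
proof -
  have "\<exists>n. t < times R n"
    using run by (auto simp: hotstuff_fastsync_run_def timing_ok_def)
  then have "t < times R (steps_until t)"
    unfolding steps_until_def by (rule LeastI_ex)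
  then show ?thesis
    using not_less_Least[of m "\<lambda>n. t < times R n"] times_mono[of "steps_until t" m]
    unfolding steps_until_def by fastforce
qed

lemma steps_until_mono: "t \<le> u \<Longrightarrow> steps_until t \<le> steps_until u"
  using less_steps_until_iff by (meson leI order_less_irrefl order_trans)

text \<open>All progress comes from here: a handler required at time \<open>t\<close> cannot still
  be waiting once the steps of time \<open>t\<close> are over.\<close>

lemma not_due:
  assumes "0 \<le> t" and "i \<in> correct S"
  shows "\<not> due S i (clock S i t) (st (steps_until t) i)"
proof -
  have "\<forall>m<steps_until t. times R m \<le> t" "t < times R (steps_until t)"
    using less_steps_until_iff[of _ t] by (auto simp: not_le[symmetric])
  then show ?thesis
    using run assms unfolding hotstuff_fastsync_run_def timing_ok_def by blast
qed

lemma delivery: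
  assumes "actor (events R k) = j" and "j \<in> correct S" and "i \<in> correct S"
    and "(i, w) \<in> sends R k" and "gst S \<le> times R k" and "times R k + delta S \<le> t"
  shows "\<exists>n<steps_until t. events R n = Receive i j k w"
proof -
  obtain n where "events R n = Receive i j k w" "times R n \<le> times R k + delta S"
    using run assms unfolding hotstuff_fastsync_run_def network_ok_def by blast
  then show ?thesis
    using less_steps_until_iff assms(6) by (meson order_trans)
qed

lemma gst_nonneg: "0 \<le> gst S" and delta_nonneg: "0 \<le> delta S"
  using run by (auto simp: hotstuff_fastsync_run_def well_formed_system_def)

end

section \<open>The first view\<close>

locale first_view_run = hotstuff_run S R
  for S :: "('v, 'h) system" and R :: "('v, 'h) run" +
  assumes gst_le_S_first: "gst S \<le> S_first S R"
    and leader_correct: "leader S 1 \<in> correct S"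
begin

section \<open>Uniqueness and buffering of view-1 messages\<close>

definition proposal :: 'v where
  "proposal = myval S (leader S 1)"

text \<open>A correct leader cannot equivocate in view 1: \<open>Lead\<close> is barred there, so it
  proposes only on entry, always \<open>myval\<close> without a certificate.\<close>

lemma propose_1_sent:
  assumes "actor (events R k) \<in> correct S" and "(d, Signed (leader S 1) (Propose 1 x C)) \<in> sends R k"
  shows "x = proposal \<and> C = None"
  using assms(2) correct_stepD(1,3)[OF assms(1) refl]
  by (cases "events R k")
    (auto simp: receive_wish_simps to_all_def proposal_def split: packet.splits if_splits)

lemma propose_1_inbox:
  assumes "i \<in> correct S" and "(leader S 1, Propose 1 x C) \<in> inbox (st n i)"
  shows "x = proposal \<and> C = None"
  using inbox_origin[OF assms leader_correct] propose_1_sent leader_correct by metis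

text \<open>Entering a view resets \<open>voted\<close>, so the value stems from a vote in view 1,
  where \<open>safe_proposal\<close> admits only the leader's proposal.\<close>

lemma curr_val_proposal:
  assumes "i \<in> correct S" and "curr_view (st n i) = 1" and "voted (st n i) = Some True"
  shows "curr_val (st n i) = Some proposal"
  using assms
proof (induction n rule: invariant)
  case init
  then show ?case
    by (auto simp: initial_def)
next
  case (idle n)
  then show ?case
    by simp
next
  case (step n e)
  show ?case
  proof (cases "\<exists>j x C. e = Vote i j x C")
    case True
    then obtain j x C where "e = Vote i j x C"
      by blast
    then show ?thesis
      using step(4,5,7) propose_1_inbox[OF assms(1), of x C n]
      by (auto simp: safe_proposal_def)
  next
    case False
    then show ?thesis
      using step(1,3,4,5,7,8)
      by (cases e) (auto simp: receive_wish_simps split: packet.splits if_splits)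
  qed
qed

lemma view_1_msg_sent:
  assumes "actor (events R k) \<in> correct S" and "(d, Signed j m) \<in> sends R k"
    and "msg_view m = 1"
  shows "(\<exists>v xo C. m = NewLeader 1 v xo C) \<or> m = Propose 1 proposal None \<or>
    m = Prepared 1 (hash S proposal) \<or> m = Committed 1 (hash S proposal)"
proof -
  let ?i = "actor (events R k)"
  have "x = proposal" if "(leader S 1, Propose 1 x C) \<in> inbox (st k ?i)" for x C
    using propose_1_inbox[OF assms(1) that] ..
  moreover have "curr_val (st k ?i) = Some proposal"
    if "curr_view (st k ?i) = 1" "voted (st k ?i) = Some True"
    using curr_val_proposal[OF assms(1) that] .
  moreover have "h = hash S proposal"
    if "curr_val (st k ?i) = Some proposal" "map_option (hash S) (curr_val (st k ?i)) = Some h" for h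
    using that by simp
  ultimately show ?thesis
    using assms(2,3) correct_stepD(1,3)[OF assms(1) refl]
    by (cases "events R k")
      (auto simp: receive_wish_simps to_all_def proposal_def safe_proposal_def
        split: packet.splits if_splits)
qed

text \<open>A message that arrives before view 1 is entered must survive in the buffer. Its signer
  is correct and has signed nothing above view 1, whoever relays its messages, so nothing outranks
  it.\<close>

lemma inbox_complete:
  assumes "i \<in> correct S" and "wishes_le 1 n" and "k < n"
    and "events R k = Receive i j k' (Signed j m)" and "j \<in> correct S"
    and "msg_view m = 1" and "\<And>v xo C. m \<noteq> NewLeader 1 v xo C"
  shows "(j, m) \<in> inbox (st n i)"
  using assms
proof (induction n rule: invariant)
  case init
  then show ?case
    by simp
next
  case (idle n)
  then show ?case
    using wishes_le_antimono[of 1 "Suc n" n] by (auto simp: less_Suc_eq)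
next
  case (step n e)
  show ?case
  proof (cases "k = n")
    case True
    then have e: "e = Receive i j k' (Signed j m)"
      using step by simp
    \<comment> \<open>A competing message has view 1 too, and by \<open>view_1_msg_sent\<close> two
      such messages of the same type coincide.\<close>
    have "m' = m"
      if m': "(j, m') \<in> inbox (st n i)" "same_type m' m" "msg_view m \<le> msg_view m'" for m'
    proof -
      obtain k1 d1 where "k1 < n" "actor (events R k1) = j" "(d1, Signed j m') \<in> sends R k1"
        using inbox_origin[OF assms(1) m'(1) assms(5)] by blast
      moreover from this have "msg_view m' \<le> 1"
        using signed_view_le[OF step.prems(1)] assms(5) by (metis less_SucI)
      moreover have "(i, Signed j m) \<in> sends R k'" "actor (events R k') = j"
        using network[of n] step(2) e by auto
      ultimately show ?thesis
        using view_1_msg_sent[of k1 d1 j m'] view_1_msg_sent[of k' i j m] m'(2,3) assms(5,6,7)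
        by fastforce
    qed
    then have "(j, m) \<in> inbox (store j m (st n i))"
      by (intro inbox_store_insert) blast
    then show ?thesis
      using step(5) e by simp
  next
    case False
    then have IH: "(j, m) \<in> inbox (st n i)"
      using step wishes_le_antimono[of 1 "Suc n" n] by auto
    show ?thesis
    proof (cases "\<exists>j1 k1 l1 m1. e = Receive i j1 k1 (Signed l1 m1)")
      case True
      then obtain j1 k1 l1 m1 where e: "e = Receive i j1 k1 (Signed l1 m1)"
        by blast
      have "msg_view m1 \<le> msg_view m" if l1: "j = l1"
      proof -
        obtain k2 d2 where "k2 < n" "actor (events R k2) = j" "(d2, Signed j m1) \<in> sends R k2"
          using received_signed_origin[of n i j1 k1 l1 m1] step(2) e l1 assms(5) by blast
        then show ?thesis
          using signed_view_le[OF step.prems(1)] assms(5,6) by (metis less_SucI)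
      qed
      then show ?thesis
        using inbox_store_keep[OF IH, of l1 m1] step(5) e by simp
    next
      case False
      then show ?thesis
        using IH step(3,5)
        by (cases e) (auto simp: receive_wish_simps split: packet.splits)
    qed
  qed
qed

section \<open>Start times and the stabilisation time\<close>

text \<open>\<open>Min\<close> and \<open>Max\<close> are meaningful only on finite sets; each
  correct process starts exactly once and so contributes one time.\<close>

lemma finite_start_times: "finite (start_times S R)"
proof -
  have "start_times S R \<subseteq> (\<lambda>i. times R (THE n. events R n = Start i)) ` correct S"
  proof
    fix t
    assume "t \<in> start_times S R"
    then obtain n i where n: "t = times R n" "i \<in> correct S" "events R n = Start i"
      by (auto simp: start_times_def)
    have "\<exists>!n. events R n = Start i"
      using run n(2) unfolding hotstuff_fastsync_run_def starts_ok_def by blast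
    then have "(THE n. events R n = Start i) = n"
      using n(3) by (rule the1_equality)
    then show "t \<in> (\<lambda>i. times R (THE n. events R n = Start i)) ` correct S"
      using n by blast
  qed
  then show ?thesis
    using finite_surj finite_correct by blast
qed

lemma start_bounds:
  assumes "i \<in> correct S" and "events R n = Start i"
  shows "gst S \<le> times R n" and "times R n \<le> S_last S R"
proof -
  have "times R n \<in> start_times S R"
    using assms by (auto simp: start_times_def)
  then show "gst S \<le> times R n" and "times R n \<le> S_last S R"
    using finite_start_times gst_le_S_first
    by (auto simp: S_first_def S_last_def intro: order_trans)
qed

lemma gst_le_times:
  assumes "\<not> wishes_le 0 n"
  shows "gst S \<le> times R n"
proof -
  have "\<exists>k i. k < n \<and> i \<in> correct S \<and> events R k = Start i"
  proof (rule ccontr)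
    assume "\<nexists>k i. k < n \<and> i \<in> correct S \<and> events R k = Start i"
    then have "wishes_le 0 n"
      by (intro wishes_le_0) blast
    then show False
      using assms by simp
  qed
  then obtain k i where "k < n" "i \<in> correct S" "events R k = Start i"
    by blast
  then show ?thesis
    using start_bounds(1)[of i k] times_mono[of k n] by simp
qed

lemma view_plus_gst:
  assumes "i \<in> correct S" and "0 < view_plus (st (Suc n) i)"
  shows "gst S \<le> times R n"
  using assms gst_le_times view_plus_le[of 0 n "Suc n" i] by auto

text \<open>Step \<open>n\<close> may itself be the first start, so the argument has to include it,
  unlike in \<open>gst_le_times\<close>.\<close>

lemma wish_gst:
  assumes "actor (events R n) \<in> correct S" and "(d, Wish v) \<in> sends R n" and "0 < v"
  shows "gst S \<le> times R n"
proof (rule ccontr)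
  assume less: "\<not> ?thesis"
  have "wishes_le 0 (Suc n)"
  proof (rule wishes_le_0)
    fix k i
    assume "k < Suc n" "i \<in> correct S"
    then show "events R k \<noteq> Start i"
      using start_bounds(1)[of i k] times_mono[of k n] less by auto
  qed
  then show False
    using assms by (auto simp: wishes_le_def)
qed

section \<open>Local progress inside view 1\<close>

definition sent :: "nat \<Rightarrow> nat \<Rightarrow> ('v, 'h) packet \<Rightarrow> bool" where
  "sent n i w \<longleftrightarrow> (\<exists>k<n. actor (events R k) = i \<and> gst S \<le> times R k \<and> to_all S w \<subseteq> sends R k)"

lemma sent_Suc: "sent n i w \<Longrightarrow> sent (Suc n) i w"
  unfolding sent_def by (metis less_SucI)

lemma sentI:
  "actor (events R n) = i \<Longrightarrow> gst S \<le> times R n \<Longrightarrow> to_all S w \<subseteq> sends R n \<Longrightarrow> sent (Suc n) i w"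
  unfolding sent_def by blast

text \<open>Meant for runs in which no correct process has yet asked for a view above 1. The last
  disjunction lists the phases: not voted, voted, locked. \<open>e\<close> stands for the step of
  entry; the timer stays set, since its expiry would ask for view 2.\<close>

definition first_view_inv :: "nat \<Rightarrow> nat \<Rightarrow> bool" where
  "first_view_inv n i \<longleftrightarrow>
    curr_view (st n i) = view (st n i) \<and>
    (view (st n i) = 0 \<longrightarrow> voted (st n i) = None \<and> locked_view (st n i) = 0) \<and>
    (view (st n i) = 1 \<longrightarrow>
      (\<exists>e<n. view (st (Suc e) i) = 1 \<and> gst S \<le> times R e \<and>
        timer_view (st n i) = Some (clock_at e i + timeout S 1)) \<and>
      (i = leader S 1 \<longrightarrow> sent n i (Signed i (Propose 1 proposal None))) \<and>
      (voted (st n i) = Some False \<and> locked_view (st n i) = 0 \<or>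
       voted (st n i) = Some True \<and> sent n i (Signed i (Prepared 1 (hash S proposal))) \<and>
        (locked_view (st n i) = 0 \<or>
         locked_view (st n i) = 1 \<and> sent n i (Signed i (Committed 1 (hash S proposal))))))"

lemma first_view_inv_step:
  assumes i: "i \<in> correct S" and inv: "first_view_inv n i" and wishes: "wishes_le 1 (Suc n)"
    and actor: "actor (events R n) = i"
  shows "first_view_inv (Suc n) i"
proof -
  note step = correct_stepD[OF i actor]
  have wishes_n: "wishes_le 1 n"
    using wishes wishes_le_antimono by simp
  have bounds: "view (st n i) \<le> 1" "view (st (Suc n) i) \<le> 1" "view_plus (st (Suc n) i) \<le> 1"
    using view_le[OF wishes_n _ i] view_plus_le[OF wishes_n _ i] by simp_all
  have unchanged: ?thesis if
    "view (st (Suc n) i) = view (st n i)" "curr_view (st (Suc n) i) = curr_view (st n i)"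
    "voted (st (Suc n) i) = voted (st n i)" "locked_view (st (Suc n) i) = locked_view (st n i)"
    "timer_view (st (Suc n) i) = timer_view (st n i)"
    using inv that sent_Suc unfolding first_view_inv_def by (metis less_SucI)
  have gst: "gst S \<le> times R n" if "view (st (Suc n) i) = 1"
    using view_plus_gst[OF i, of n] view_le_view_plus[OF i, of "Suc n"] that by simp
  show ?thesis
  proof (cases "events R n")
    case (Start x)
    then show ?thesis
      using step(2) by (intro unchanged) auto
  next
    \<comment> \<open>Timers run only in positive views, so expiry asks for view 2 or more;
      \<open>wishes\<close> covers this very step and excludes it.\<close>
    case (Expire x)
    then have "timer_view (st n i) \<noteq> None"
      using step(1) by auto
    then have "0 < view (st n i)"
      using timer_view_positive[OF i] by blast
    moreover have "(i, Wish (max (view (st n i) + 1) (view_plus (st n i)))) \<in> sends R n"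
      using step(3) Expire actor i correct_procs by (auto simp: to_all_def)
    ultimately have False
      using wishes actor i unfolding wishes_le_def by fastforce
    then show ?thesis ..
  next
    case (Retransmit x)
    then show ?thesis
      using step(2) by (intro unchanged) auto
  next
    case (Receive x j k w)
    show ?thesis
    proof (cases w)
      case (Wish v)
      have st': "st (Suc n) i = fst (receive_wish S i (clock_at n i) j v (st n i))"
        "sends R n = snd (receive_wish S i (clock_at n i) j v (st n i))"
        using step(2,3) Receive Wish actor by auto
      show ?thesis
      proof (cases "view (st (Suc n) i) = view (st n i)")
        case True
        then show ?thesis
          by (intro unchanged) (auto simp: st' receive_wish_simps)
      next
        case False
        \<comment> \<open>\<open>view_plus\<close> lies between the new \<open>view\<close> and the
          bound 1, so the two agree and \<open>new_view\<close> is really issued.\<close>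
        then have enters: "view (st n i) = 0" "view (st (Suc n) i) = 1" "view_plus (st (Suc n) i) = 1"
          using bounds views_Suc_mono[OF i, of n] view_le_view_plus[OF i, of "Suc n"] by auto
        then have "curr_view (st (Suc n) i) = 1"
          "timer_view (st (Suc n) i) = Some (clock_at n i + timeout S 1)"
          "voted (st (Suc n) i) = Some False"
          "locked_view (st (Suc n) i) = locked_view (st n i)"
          "i = leader S 1 \<longrightarrow> to_all S (Signed i (Propose 1 proposal None)) \<subseteq> sends R n"
          unfolding st' by (auto simp: receive_wish_simps proposal_def)
        then show ?thesis
          using enters inv gst sentI[OF actor] unfolding first_view_inv_def by auto
      qed
    next
      case (Signed l m)
      then show ?thesis
        using step(2) Receive by (intro unchanged) auto
    qed
  next
    case (Lead x v C)
    then show ?thesis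
      using step(2) by (intro unchanged) auto
  next
    case (Vote x j y C)
    \<comment> \<open>In view 0 \<open>voted\<close> is \<open>None\<close>, so the guard places the
      process in view 1; likewise for \<open>Prepare\<close> below.\<close>
    have view: "view (st n i) = 1" "curr_view (st n i) = 1"
      using inv step(1) Vote bounds unfolding first_view_inv_def by (auto simp: le_Suc_eq)
    then have "y = proposal"
      using step(1) Vote propose_1_inbox[OF i] by (auto simp: safe_proposal_def)
    then have new: "view (st (Suc n) i) = 1" "curr_view (st (Suc n) i) = 1"
      "voted (st (Suc n) i) = Some True" "timer_view (st (Suc n) i) = timer_view (st n i)"
      "locked_view (st (Suc n) i) = 0"
      "to_all S (Signed i (Prepared 1 (hash S proposal))) \<subseteq> sends R n"
      using step Vote actor view inv by (auto simp: first_view_inv_def)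
    then have "sent (Suc n) i (Signed i (Prepared 1 (hash S proposal)))"
      using sentI[OF actor] gst by blast
    moreover have "\<exists>e<Suc n. view (st (Suc e) i) = 1 \<and> gst S \<le> times R e \<and>
        timer_view (st n i) = Some (clock_at e i + timeout S 1)"
      "i = leader S 1 \<longrightarrow> sent (Suc n) i (Signed i (Propose 1 proposal None))"
      using view inv sent_Suc unfolding first_view_inv_def by (metis less_SucI)+
    ultimately show ?thesis
      using new unfolding first_view_inv_def by simp
  next
    case (Prepare x h Q)
    have view: "view (st n i) = 1" "curr_view (st n i) = 1"
      using inv step(1) Prepare bounds unfolding first_view_inv_def by (auto simp: le_Suc_eq)
    then have "h = hash S proposal"
      using step(1) Prepare curr_val_proposal[OF i] by auto
    then have new: "view (st (Suc n) i) = 1" "curr_view (st (Suc n) i) = 1"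
      "voted (st (Suc n) i) = Some True" "timer_view (st (Suc n) i) = timer_view (st n i)"
      "locked_view (st (Suc n) i) = 1"
      "to_all S (Signed i (Committed 1 (hash S proposal))) \<subseteq> sends R n"
      using step Prepare actor view by auto
    then have "sent (Suc n) i (Signed i (Committed 1 (hash S proposal)))"
      using sentI[OF actor] gst by blast
    moreover have "\<exists>e<Suc n. view (st (Suc e) i) = 1 \<and> gst S \<le> times R e \<and>
        timer_view (st n i) = Some (clock_at e i + timeout S 1)"
      "i = leader S 1 \<longrightarrow> sent (Suc n) i (Signed i (Propose 1 proposal None))"
      using view inv sent_Suc unfolding first_view_inv_def by (metis less_SucI)+
    moreover have "sent (Suc n) i (Signed i (Prepared 1 (hash S proposal)))"
      using view inv sent_Suc step(1) Prepare unfolding first_view_inv_def by auto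
    ultimately show ?thesis
      using new unfolding first_view_inv_def by simp
  next
    case (Decide x h Q)
    then show ?thesis
      using step(2) by (intro unchanged) auto
  next
    case (Byzantine x A)
    then show ?thesis
      using step(1) by simp
  qed
qed

lemma first_view_inv:
  assumes "i \<in> correct S" and "wishes_le 1 n"
  shows "first_view_inv n i"
  using assms(2)
proof (induction n)
  case 0
  have "view (st 0 i) = 0" "curr_view (st 0 i) = 0" "voted (st 0 i) = None"
    "locked_view (st 0 i) = 0"
    using initial_state[OF assms(1)] by (auto simp: initial_def)
  then show ?case
    by (simp add: first_view_inv_def)
next
  case (Suc n)
  then have inv: "first_view_inv n i"
    using wishes_le_antimono by simp
  show ?case
  proof (cases "actor (events R n) = i")
    case False
    then show ?thesis
      using inv idle[OF assms(1) False] sent_Suc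
      unfolding first_view_inv_def by (metis less_SucI)
  qed (use first_view_inv_step[OF assms(1) inv] Suc.prems in blast)
qed

text \<open>A correct process only asks for a view above 1 after its timer for view 1 has expired, so a full
  \<open>timeout S 1\<close> after some correct process has entered view 1.\<close>

lemma first_wish_above_1:
  assumes "wishes_le 1 n" and "\<not> wishes_le 1 (Suc n)"
  shows "\<exists>i\<in>correct S. \<exists>e<n. 0 < view (st (Suc e) i) \<and> times R e + timeout S 1 \<le> times R n"
proof -
  define i where "i = actor (events R n)"
  obtain d v where i: "i \<in> correct S" and v: "(d, Wish v) \<in> sends R n" "1 < v"
    using assms unfolding wishes_le_def i_def by (metis less_Suc_eq not_le)
  note step = correct_stepD[OF i i_def[symmetric]]
  have inv: "first_view_inv n i"
    using first_view_inv[OF i assms(1)] .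
  have bounds: "view (st n i) \<le> 1" "view_plus (st n i) \<le> 1" "view_plus (st (Suc n) i) \<le> 1"
    using view_le[OF assms(1) _ i] view_plus_le[OF assms(1) _ i] by simp_all
  have timer: "timer_view (st n i) \<noteq> None \<longleftrightarrow> view (st n i) = 1"
    using inv bounds timer_view_positive[OF i, of n] unfolding first_view_inv_def by force
  have not_receive: False if "events R n = Receive i j k (Wish u)" for j k u
  proof -
    have "v = view_plus (st (Suc n) i)"
      using step(2,3) that v
      by (auto simp: receive_wish_simps to_all_def split: if_splits)
    then show False
      using bounds v by simp
  qed
  \<comment> \<open>A retransmission with the timer off happens only in view 0 and asks for view 1;
    with the timer on it asks for \<open>view_plus\<close>, at most 1.\<close>
  have "\<exists>x. events R n = Expire x"
    using step(1,3) v timer bounds i_def not_receive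
    by (cases "events R n") (auto simp: to_all_def le_Suc_eq split: packet.splits if_splits)
  then obtain d' where d': "timer_view (st n i) = Some d'" "d' \<le> clock_at n i"
    using step(1) by auto
  then obtain e where e: "e < n" "view (st (Suc e) i) = 1" "gst S \<le> times R e"
    "d' = clock_at e i + timeout S 1"
    using inv timer unfolding first_view_inv_def by auto
  \<comment> \<open>Both steps come after \<open>gst\<close>, where local clocks advance with real
    time.\<close>
  have "clock_at n i - clock_at e i = times R n - times R e"
    using run i e times_mono[of e n]
    by (auto simp: hotstuff_fastsync_run_def well_formed_system_def)
  then show ?thesis
    using e d' i by (intro bexI[of _ i] exI[of _ e]) auto
qed

section \<open>Time bounds for entering a view\<close>

lemma wish_received:
  assumes "actor (events R k) = j" and "j \<in> correct S" and "i \<in> correct S"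
    and "(i, Wish v) \<in> sends R k" and "0 < v" and "times R k + delta S \<le> t"
  shows "v \<le> max_views (st (steps_until t) i) j"
proof -
  have "gst S \<le> times R k"
    using wish_gst assms by blast
  then obtain n where "n < steps_until t" "events R n = Receive i j k (Wish v)"
    using delivery assms by blast
  then show ?thesis
    using max_views_received assms(3) by blast
qed

text \<open>The correct processes contain a quorum. Their wishes may be for different views, so only
  positivity follows; the upper bound 1 comes from \<open>wishes_le\<close>.\<close>

lemma view_positive:
  assumes "\<And>j. j \<in> correct S \<Longrightarrow> \<exists>k v. actor (events R k) = j \<and> 0 < v \<and>
      to_all S (Wish v) \<subseteq> sends R k \<and> times R k \<le> t"
    and "i \<in> correct S"
  shows "0 < view (st (steps_until (t + delta S)) i)"
proof -
  let ?n = "steps_until (t + delta S)"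
  have "correct S \<subseteq> {j \<in> procs S. 1 \<le> max_views (st ?n i) j}"
  proof
    fix j
    assume j: "j \<in> correct S"
    then obtain k v where "actor (events R k) = j" "0 < v"
      "to_all S (Wish v) \<subseteq> sends R k" "times R k \<le> t"
      using assms(1) by blast
    moreover from this have "(i, Wish v) \<in> sends R k"
      using correct_procs[OF assms(2)] by (auto simp: to_all_def)
    ultimately have "v \<le> max_views (st ?n i) j"
      using wish_received[of k j i v] j assms(2) by simp
    then show "j \<in> {j \<in> procs S. 1 \<le> max_views (st ?n i) j}"
      using \<open>0 < v\<close> correct_procs[OF j] by simp
  qed
  then have "card (correct S) \<le> card {j \<in> procs S. 1 \<le> max_views (st ?n i) j}"
    by (intro card_mono) auto
  then show ?thesis
    using card_correct le_view_iff[OF assms(2), of 1 ?n] by simp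
qed

text \<open>\<open>Start\<close> is silent if \<open>view_plus\<close> is already positive, but then
  the earlier wish that announced a rise serves as well.\<close>

lemma view_positive_S_last:
  assumes "i \<in> correct S"
  shows "0 < view (st (steps_until (S_last S R + delta S)) i)"
proof (rule view_positive[OF _ assms])
  fix j
  assume j: "j \<in> correct S"
  obtain n where n: "events R n = Start j"
    using run j unfolding hotstuff_fastsync_run_def starts_ok_def by blast
  have S_last: "times R n \<le> S_last S R"
    using start_bounds(2)[OF j n] .
  show "\<exists>k v. actor (events R k) = j \<and> 0 < v \<and>
      to_all S (Wish v) \<subseteq> sends R k \<and> times R k \<le> S_last S R"
  proof (cases "view_plus (st n j) = 0")
    case True
    then have "sends R n = to_all S (Wish 1)"
      using correct_stepD(3)[OF j, of n] n by simp
    then show ?thesis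
      using n S_last by (intro exI[of _ n] exI[of _ 1]) simp
  next
    case False
    then obtain k v where "k < n" "0 < v" "actor (events R k) = j" "to_all S (Wish v) \<subseteq> sends R k"
      using view_plus_wish_sent[OF j, of n] by auto
    then show ?thesis
      using times_mono[of k n] S_last by fastforce
  qed
qed

text \<open>Among the \<open>2f + 1\<close> wishes that let the first process enter a view, \<open>f + 1\<close> come from correct
  processes. They reach everybody within \<open>delta S\<close> and make everybody send a wish of their own.\<close>

lemma view_positive_spread:
  assumes "i \<in> correct S" and "0 < view (st (Suc e) i)" and "i' \<in> correct S"
  shows "0 < view (st (steps_until (times R e + 2 * delta S)) i')"
proof -
  let ?t = "times R e + delta S"
  let ?A = "{j \<in> procs S. 1 \<le> max_views (st (Suc e) i) j}"
  have "2 * max_faulty S + 1 \<le> card ?A"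
    using le_view_iff[OF assms(1), of 1 "Suc e"] assms(2) by simp
  moreover have "card ?A \<le> card (?A \<inter> correct S) + max_faulty S"
    by (intro card_correct_part) auto
  ultimately have card: "max_faulty S + 1 \<le> card (?A \<inter> correct S)"
    by simp
  have "0 < view (st (steps_until (?t + delta S)) i')"
  proof (rule view_positive[OF _ assms(3)])
    fix j
    assume j: "j \<in> correct S"
    have "?A \<inter> correct S \<subseteq> {l \<in> procs S. 1 \<le> max_views (st (steps_until ?t) j) l}"
    proof
      fix l
      assume "l \<in> ?A \<inter> correct S"
      then have l: "0 < max_views (st (Suc e) i) l" "l \<in> correct S"
        by auto
      let ?v = "max_views (st (Suc e) i) l"
      obtain k where k: "Suc k < Suc e" "actor (events R k) = l" "(i, Wish ?v) \<in> sends R k"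
        using max_views_source[OF assms(1) l(1)] by blast
      have "(j, Wish ?v) \<in> sends R k"
        using wish_sent_to_all[OF _ k(3)] k(2) l(2) j correct_procs by blast
      moreover have "times R k + delta S \<le> ?t"
        using times_mono[of k e] k(1) by simp
      ultimately have "?v \<le> max_views (st (steps_until ?t) j) l"
        using wish_received[OF k(2) l(2) j] l(1) by blast
      then show "l \<in> {l \<in> procs S. 1 \<le> max_views (st (steps_until ?t) j) l}"
        using l correct_procs by simp
    qed
    then have "card (?A \<inter> correct S) \<le> card {l \<in> procs S. 1 \<le> max_views (st (steps_until ?t) j) l}"
      by (intro card_mono) auto
    then have "0 < view_plus (st (steps_until ?t) j)"
      using card le_view_plus_iff[OF j, of 1 "steps_until ?t"] by simp
    then show "\<exists>k v. actor (events R k) = j \<and> 0 < v \<and>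
        to_all S (Wish v) \<subseteq> sends R k \<and> times R k \<le> ?t"
      using view_plus_wish_sent[OF j] less_steps_until_iff by blast
  qed
  then show ?thesis
    by (simp add: algebra_simps)
qed

section \<open>From the absence of timeouts to decisions\<close>

text \<open>Induction breaks the circle: if the bound holds before a step, a violation at that step
  needs an expired view-1 timer, and none has run out by \<open>t\<close>.\<close>

lemma wishes_le_1:
  assumes "\<And>e i. i \<in> correct S \<Longrightarrow> 0 < view (st (Suc e) i) \<Longrightarrow> t < times R e + timeout S 1"
  shows "wishes_le 1 (steps_until t)"
proof -
  have "wishes_le 1 n" if "n \<le> steps_until t" for n
    using that
  proof (induction n)
    case 0
    then show ?case
      by (simp add: wishes_le_def)
  next
    case (Suc n)
    show ?case
    proof (rule ccontr)
      assume "\<not> wishes_le 1 (Suc n)"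
      then obtain i e where "i \<in> correct S" "0 < view (st (Suc e) i)"
        "times R e + timeout S 1 \<le> times R n"
        using first_wish_above_1[of n] Suc by auto
      moreover have "times R n \<le> t"
        using Suc.prems less_steps_until_iff[of n t] by simp
      ultimately show False
        using assms[of i e] by simp
    qed
  qed
  then show ?thesis
    by simp
qed

lemma sent_in_inbox:
  assumes "wishes_le 1 (steps_until u)" and "t + delta S \<le> u"
    and "i \<in> correct S" and "j \<in> correct S"
    and "sent (steps_until t) j (Signed j m)" and "msg_view m = 1"
    and "\<And>v xo C. m \<noteq> NewLeader 1 v xo C"
  shows "(j, m) \<in> inbox (st (steps_until u) i)"
proof -
  obtain k where k: "k < steps_until t" "actor (events R k) = j" "gst S \<le> times R k"
    "to_all S (Signed j m) \<subseteq> sends R k"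
    using assms(5) unfolding sent_def by blast
  then have "(i, Signed j m) \<in> sends R k" "times R k + delta S \<le> u"
    using correct_procs[OF assms(3)] assms(2) less_steps_until_iff[of k t]
    by (auto simp: to_all_def)
  then obtain n where "n < steps_until u" "events R n = Receive i j k (Signed j m)"
    using delivery[of k j i] k assms(3,4) by blast
  then show ?thesis
    using inbox_complete[OF assms(3,1)] assms(4,6,7) by blast
qed

lemma all_decide:
  assumes "0 \<le> t" and "\<And>i. i \<in> correct S \<Longrightarrow> 0 < view (st (steps_until t) i)"
    and "wishes_le 1 (steps_until (t + 3 * delta S))" and "i \<in> correct S"
  shows "\<exists>x t'. decides_at R i x t' \<and> t' \<le> t + 3 * delta S"
proof -
  have state: "wishes_le 1 (steps_until u)" "curr_view (st (steps_until u) j) = 1"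
    "view (st (steps_until u) j) = 1" "first_view_inv (steps_until u) j"
    "\<not> due S j (clock S j u) (st (steps_until u) j)"
    if "t \<le> u" "u \<le> t + 3 * delta S" "j \<in> correct S" for u j
  proof -
    show wishes: "wishes_le 1 (steps_until u)"
      using assms(3) wishes_le_antimono steps_until_mono[OF that(2)] by blast
    show inv: "first_view_inv (steps_until u) j"
      using first_view_inv[OF that(3) wishes] .
    have "view (st (steps_until t) j) \<le> view (st (steps_until u) j)"
      using views_mono[OF that(3) steps_until_mono[OF that(1)]] .
    then show view: "view (st (steps_until u) j) = 1"
      using assms(2)[OF that(3)] view_le[OF wishes _ that(3), of "steps_until u"] by simp
    show "curr_view (st (steps_until u) j) = 1"
      using inv view unfolding first_view_inv_def by simp
    show "\<not> due S j (clock S j u) (st (steps_until u) j)"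
      using not_due that assms(1) by simp
  qed
  obtain Q where Q: "quorum S Q" "Q \<subseteq> correct S"
    using correct_quorum .
  have d: "0 \<le> delta S"
    using delta_nonneg .
  have proposed: "sent (steps_until t) (leader S 1) (Signed (leader S 1) (Propose 1 proposal None))"
    using state(3,4)[OF _ _ leader_correct, of t] d unfolding first_view_inv_def by simp
  \<comment> \<open>Each phase is claimed for every \<open>u\<close> from its deadline on: at the
    deadline it supplies the packets for the next phase, later the guard of the next
    handler.\<close>
  have voted: "voted (st (steps_until u) j) = Some True \<and>
      curr_val (st (steps_until u) j) = Some proposal \<and>
      sent (steps_until u) j (Signed j (Prepared 1 (hash S proposal)))"
    if u: "t + delta S \<le> u" "u \<le> t + 3 * delta S" and j: "j \<in> correct S" for u j
  proof -
    have "t \<le> u"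
      using u d by simp
    note state = state[OF this u(2) j]
    have "(leader S 1, Propose 1 proposal None) \<in> inbox (st (steps_until u) j)"
      using sent_in_inbox[OF state(1) u(1) j leader_correct proposed] by simp
    moreover have "valid S proposal"
      using run leader_correct
      by (auto simp: proposal_def hotstuff_fastsync_run_def well_formed_system_def)
    \<comment> \<open>With \<open>locked_view\<close> still 0, \<open>safe_proposal\<close> asks for
      no certificate.\<close>
    ultimately have "enabled S (clock S j u) (st (steps_until u) j) (Vote j (leader S 1) proposal None)"
      if "voted (st (steps_until u) j) = Some False" "locked_view (st (steps_until u) j) = 0"
      using state(2) that by (simp add: safe_proposal_def)
    then have "\<not> (voted (st (steps_until u) j) = Some False \<and> locked_view (st (steps_until u) j) = 0)"
      using state(5) unfolding due_def by blast
    then have voted: "voted (st (steps_until u) j) = Some True \<and>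
        sent (steps_until u) j (Signed j (Prepared 1 (hash S proposal)))"
      using state(3,4) unfolding first_view_inv_def by auto
    then show ?thesis
      using curr_val_proposal[OF j state(2)] by blast
  qed
  have locked: "locked_view (st (steps_until u) j) = 1 \<and>
      sent (steps_until u) j (Signed j (Committed 1 (hash S proposal)))"
    if u: "t + 2 * delta S \<le> u" "u \<le> t + 3 * delta S" and j: "j \<in> correct S" for u j
  proof -
    have "t \<le> u" "t + delta S \<le> u" "t + delta S + delta S \<le> u"
      using u d by simp_all
    note state = state[OF this(1) u(2) j] and voted_u = voted[OF this(2) u(2) j] and u' = this(3)
    have "(l, Prepared 1 (hash S proposal)) \<in> inbox (st (steps_until u) j)" if l: "l \<in> Q" for l
    proof -
      have l': "l \<in> correct S"
        using l Q(2) by blast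
      have "sent (steps_until (t + delta S)) l (Signed l (Prepared 1 (hash S proposal)))"
        using voted[OF _ _ l', of "t + delta S"] d by simp
      then show ?thesis
        using sent_in_inbox[OF state(1) u' j l'] by simp
    qed
    then have "enabled S (clock S j u) (st (steps_until u) j) (Prepare j (hash S proposal) Q)"
      using Q(1) voted_u state(2) by simp
    \<comment> \<open>An enabled \<open>Prepare\<close> fails to be due only if
      \<open>locked_view\<close> equals \<open>curr_view\<close>, that is, if it has already
      run.\<close>
    then have "locked_view (st (steps_until u) j) = 1"
      using state(2,5) unfolding due_def by metis
    then show ?thesis
      using state(3,4) unfolding first_view_inv_def by auto
  qed
  define u where "u = t + 3 * delta S"
  have u: "t \<le> u" "t + delta S \<le> u" "t + 2 * delta S \<le> u" "t + 2 * delta S + delta S \<le> u"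
    "u \<le> t + 3 * delta S"
    using d by (simp_all add: u_def)
  note state = state[OF u(1,5) assms(4)]
  have "(l, Committed 1 (hash S proposal)) \<in> inbox (st (steps_until u) i)" if l: "l \<in> Q" for l
  proof -
    have l': "l \<in> correct S"
      using l Q(2) by blast
    have "sent (steps_until (t + 2 * delta S)) l (Signed l (Committed 1 (hash S proposal)))"
      using locked[OF _ _ l', of "t + 2 * delta S"] d by simp
    then show ?thesis
      using sent_in_inbox[OF state(1) u(4) assms(4) l'] by simp
  qed
  then have "enabled S (clock S i u) (st (steps_until u) i) (Decide i (hash S proposal) Q)"
    using Q(1) voted[OF u(2,5) assms(4)] locked[OF u(3,5) assms(4)] state(2) by simp
  then have "decided_view (st (steps_until u) i) = 1"
    using state(2,5) unfolding due_def by metis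
  then obtain k x where "k < steps_until u" "decides_at R i x (times R k)"
    using decided_view_source[OF assms(4), of "steps_until u"] by auto
  then show ?thesis
    using less_steps_until_iff[of k u] u_def by blast
qed

lemma decide_by:
  assumes timeout: "5 * delta S < timeout S 1" and i: "i \<in> correct S"
  shows "\<exists>x t. decides_at R i x t \<and> t \<le> S_last S R + 4 * delta S"
proof -
  define entered where "entered e \<longleftrightarrow> (\<exists>i\<in>correct S. 0 < view (st (Suc e) i))" for e
  let ?n = "steps_until (S_last S R + delta S)"
  have "view (st 0 i) = 0"
    using initial_state[OF i] by (auto simp: initial_def)
  then have "?n \<noteq> 0"
    using view_positive_S_last[OF i] by (metis less_irrefl)
  \<comment> \<open>Entries are indexed by the step that causes them, so the witness is the last
    step before \<open>?n\<close>.\<close>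
  then have "entered (?n - 1)"
    using view_positive_S_last[OF i] i unfolding entered_def by auto
  then have e: "entered (Least entered)" and least: "\<And>e. entered e \<Longrightarrow> Least entered \<le> e"
    by (auto intro: LeastI Least_le)
  define e where "e = Least entered"
  obtain i0 where i0: "i0 \<in> correct S" "0 < view (st (Suc e) i0)"
    using e unfolding entered_def e_def by blast
  define t where "t = min (times R e + 2 * delta S) (S_last S R + delta S)"
  have "gst S \<le> times R e"
    using view_plus_gst[OF i0(1), of e] view_le_view_plus[OF i0(1), of "Suc e"] i0(2) by simp
  moreover have "gst S \<le> S_last S R"
  proof -
    obtain n where "events R n = Start i"
      using run i unfolding hotstuff_fastsync_run_def starts_ok_def by blast
    then show ?thesis
      using start_bounds[OF i] by fastforce
  qed
  ultimately have "0 \<le> t"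
    using gst_nonneg delta_nonneg by (simp add: t_def)
  moreover have "0 < view (st (steps_until t) j)" if "j \<in> correct S" for j
    using view_positive_spread[OF i0 that] view_positive_S_last[OF that]
    by (simp add: t_def min_def)
  moreover have "wishes_le 1 (steps_until (t + 3 * delta S))"
  proof (rule wishes_le_1)
    fix e' j
    assume "j \<in> correct S" "0 < view (st (Suc e') j)"
    then have "times R e \<le> times R e'"
      using least times_mono unfolding entered_def e_def by blast
    \<comment> \<open>The first term of the minimum puts \<open>t + 3 * delta S\<close> at most
      \<open>5 * delta S\<close> after the first entry, and \<open>e'\<close> is no earlier than
      that entry.\<close>
    then show "t + 3 * delta S < times R e' + timeout S 1"
      using timeout by (simp add: t_def min_def)
  qed
  ultimately obtain x t' where "decides_at R i x t'" "t' \<le> t + 3 * delta S"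
    using all_decide i by blast
  then show ?thesis
    by (intro exI[of _ x] exI[of _ t']) (simp add: t_def min_def split: if_splits)
qed

end

theorem corollary14:
  fixes S :: "('v, 'h) system" and R :: "('v, 'h) run"
  assumes "hotstuff_fastsync_run S R"
    and "S_first S R \<ge> gst S"
    and "timeout S 1 > 5 * delta S"
    and "leader S 1 \<in> correct S"
  shows "\<forall>i\<in>correct S. \<exists>x t. decides_at R i x t \<and> t \<le> S_last S R + 4 * delta S"
proof -
  interpret first_view_run S R
    using assms by unfold_locales auto
  show ?thesis
    using decide_by assms(3) by blast
qed

end
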